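(* Let $(x^{(t)},y^{(t)})_{t\ge 0}$ be generated by the DSPDC algorithm (described in the context) with sample sizes $m\in\{1,\dots,n\}$ (dual) and $q\in\{1,\dots,p\}$ (primal). Let $\Lambda>0$ be any constant with $\Lambda\ge\Lambda_{q,m}$, and suppose $\tau,\sigma>0$ satisfy $$\tau\sigma=\frac{nmq}{4p\Lambda},\qquad \frac{p}{2q\lambda\tau}+\frac{p}{q}=\frac{n^2}{2m\gamma\sigma}+\frac{n}{m},$$ while $$\theta=\frac{p}{q}-\frac{p/q}{2\sqrt{\frac{\Lambda}{\lambda\gamma n}}\frac{np}{mq}+2\max\{\frac{n}{m},\frac{p}{q}\}}.$$ Then for each $t\ge0$, $$\mathbb{E}\left[P(x^{(t)})-D(y^{(t)})\right]\le\left(1-\frac{1}{2\sqrt{\frac{\Lambda}{\lambda\gamma n}}\frac{np}{mq}+2\max\{\frac{n}{m},\frac{p}{q}\}}\right)^t\times\left\{\frac{1}{\min\left\{\frac{p}{q},\frac{n}{m}\right\}}+\frac{\max\left\{\frac{\|A\|_2^2}{n\gamma},\frac{\|A\|_2^2}{\lambda n^2}\right\}}{\min\left\{\frac{\lambda p}{q},\frac{\gamma}{m}\right\}}\right\}$$ $$\times\left[\left(\frac{p}{2q\tau}+\frac{p\lambda}{2q}\right)\|x^{(0)}-x^\star\|^2+\left(\frac{n}{2m\sigma}+\frac{\gamma}{2m}\right)\|y^{(0)}-y^\star\|^2+\max\left\{\frac{p}{q},\frac{n}{m}\right\}\left(P(x^{(0)})-D(y^{(0)})\right)\right].$$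
   Context: Setting. Let $A\in\mathbb{R}^{n\times p}$ have rows $a_1^T,\dots,a_n^T$; $A_i$ denotes the $i$-th row and $A^j$ the $j$-th column, and for $I\subset\{1,\dots,n\}$, $J\subset\{1,\dots,p\}$, $A_I^J$ is the submatrix with rows in $I$ and columns in $J$. Let $\lambda,\gamma>0$. Let $g(x)=\sum_{j=1}^p g_j(x_j)$, where each $g_j:\mathbb{R}\to\mathbb{R}$ is $\lambda$-strongly convex: $g_j(\alpha)\ge g_j(\beta)+g_j'(\beta)(\alpha-\beta)+\frac{\lambda}{2}(\alpha-\beta)^2$ for all $\alpha,\beta\in\mathbb{R}$ ($g_j'(\beta)$ a subgradient). Each $\phi_i:\mathbb{R}\to\mathbb{R}$, $i=1,\dots,n$, is convex, differentiable and $(1/\gamma)$-smooth: $\phi_i(\alpha)\le\phi_i(\beta)+\nabla\phi_i(\beta)(\alpha-\beta)+\frac{1}{2\gamma}(\alpha-\beta)^2$ for all $\alpha,\beta$. The convex conjugates are $\phi_i^*(\alpha)=\sup_{\beta\in\mathbb{R}}\{\alpha\beta-\phi_i(\beta)\}$ (possibly $+\infty$) and $g^*(v)=\sup_u\{\langle u,v\rangle-g(u)\}$. Primal objective: $P(x)=\frac1n\sum_{i=1}^n\phi_i(a_i^Tx)+g(x)$, minimized over $\mathbb{R}^p$ at $x^\star$. Dual objective: $D(y)=-g^*(-A^Ty/n)-\frac1n\sum_{i=1}^n\phi_i^*(y_i)$ (with value $-\infty$ if some $\phi_i^*(y_i)=+\infty$), maximized over $\mathbb{R}^n$ at $y^\star$.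 The pair $(x^\star,y^\star)$ is the saddle point of $\min_x\max_y\{g(x)+\frac1n y^TAx-\frac1n\sum_i\phi_i^*(y_i)\}$. $\|\cdot\|$ is the Euclidean norm of vectors, $\|\cdot\|_2$ the spectral norm of matrices, and $\Lambda_{q,m}=\max\{\|A_I^J\|_2^2: I\subset\{1,\dots,n\},J\subset\{1,\dots,p\},|I|=m,|J|=q\}$. DSPDC algorithm. Start from deterministic $x^{(-1)}=x^{(0)}=\bar x^{(0)}\in\mathbb{R}^p$, $y^{(-1)}=y^{(0)}=\bar y^{(0)}\in\mathbb{R}^n$, with parameters $(\theta,\tau,\sigma)$. For $t=0,1,2,\dots$: draw uniformly at random $I\subset\{1,\dots,n\}$ with $|I|=m$ and $J\subset\{1,\dots,p\}$ with $|J|=q$ (independent of each other and of the past), and set - $y_i^{(t+1)}=\arg\max_{\beta\in\mathbb{R}}\{\frac1n\langle A_i,\bar x^{(t)}\rangle\beta-\frac{\phi_i^*(\beta)}{n}-\frac{1}{2\sigma}(\beta-y_i^{(t)})^2\}$ if $i\in I$, and $y_i^{(t+1)}=y_i^{(t)}$ if $i\notin I$; - $\bar y^{(t+1)}=y^{(t)}+\frac nm(y^{(t+1)}-y^{(t)})$; - $x_j^{(t+1)}=\arg\min_{\alpha\in\mathbb{R}}\{\frac1n\langle A^j,\bar y^{(t+1)}\rangle\alpha+g_j(\alpha)+\frac{1}{2\tau}(\alpha-x_j^{(t)})^2\}$ if $j\in J$, and $x_j^{(t+1)}=x_j^{(t)}$ if $j\notin J$; - $\bar x^{(t+1)}=x^{(t)}+(\theta+1)(x^{(t+1)}-x^{(t)})$.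 $\mathbb{E}$ is expectation over all random draws. *)

theory Defs
  imports "HOL-Probability.Probability"
begin

subsection \<open>Convexity notions\<close>

definition is_subgradient :: "(real \<Rightarrow> real) \<Rightarrow> real \<Rightarrow> real \<Rightarrow> bool" where
  "is_subgradient f \<beta> s \<longleftrightarrow> (\<forall>\<alpha>. f \<alpha> \<ge> f \<beta> + s * (\<alpha> - \<beta>))"

definition strongly_convex :: "real \<Rightarrow> (real \<Rightarrow> real) \<Rightarrow> bool" where
  "strongly_convex lam f \<longleftrightarrow>
     (\<exists>f'. (\<forall>\<beta>. is_subgradient f \<beta> (f' \<beta>)) \<and>
           (\<forall>\<alpha> \<beta>. f \<alpha> \<ge> f \<beta> + f' \<beta> * (\<alpha> - \<beta>) + lam / 2 * (\<alpha> - \<beta>)\<^sup>2))"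

definition smooth :: "real \<Rightarrow> (real \<Rightarrow> real) \<Rightarrow> bool" where
  "smooth L f \<longleftrightarrow>
     (\<forall>\<beta>. f differentiable (at \<beta>)) \<and>
     (\<forall>\<alpha> \<beta>. f \<alpha> \<le> f \<beta> + deriv f \<beta> * (\<alpha> - \<beta>) + L / 2 * (\<alpha> - \<beta>)\<^sup>2)"

definition convex_conjugate :: "('a::real_inner \<Rightarrow> real) \<Rightarrow> 'a \<Rightarrow> ereal" where
  "convex_conjugate f v = (SUP u. ereal (u \<bullet> v - f u))"

subsection \<open>Spectral norms of submatrices\<close>

definition spectral_norm :: "real^'p^'n \<Rightarrow> real" where
  "spectral_norm M = onorm ((*v) M)"

text \<open>The submatrix with rows in \<open>I\<close> and columns in \<open>J\<close> is padded with zeros to the full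
  format; this leaves its spectral norm unchanged.\<close>

definition submatrix :: "real^'p^'n \<Rightarrow> 'n set \<Rightarrow> 'p set \<Rightarrow> real^'p^'n" where
  "submatrix A I J = (\<chi> i j. if i \<in> I \<and> j \<in> J then A $ i $ j else 0)"

definition Lambda_max :: "real^'p^'n \<Rightarrow> nat \<Rightarrow> nat \<Rightarrow> real" where
  "Lambda_max A q m =
     Max {(spectral_norm (submatrix A I J))\<^sup>2 | I J. card I = m \<and> card J = q}"

subsection \<open>Primal and dual objectives\<close>

definition separable :: "('p \<Rightarrow> real \<Rightarrow> real) \<Rightarrow> real^'p \<Rightarrow> real" where
  "separable g x = (\<Sum>j\<in>UNIV. g j (x $ j))"

definition primal_obj ::
  "real^'p^'n \<Rightarrow> ('n \<Rightarrow> real \<Rightarrow> real) \<Rightarrow> ('p \<Rightarrow> real \<Rightarrow> real) \<Rightarrow> real^'p \<Rightarrow> real" where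
  "primal_obj A \<phi> g x =
     1 / real CARD('n) * (\<Sum>i\<in>UNIV. \<phi> i (row i A \<bullet> x)) + separable g x"

text \<open>The conjugate of \<open>\<phi> i\<close> may take the value \<open>\<infinity>\<close>, and then the dual objective is \<open>-\<infinity>\<close>.
  Under strong convexity of all \<open>g j\<close> the first conjugate is finite, so that no
  indeterminate difference occurs.\<close>

definition dual_obj ::
  "real^'p^'n \<Rightarrow> ('n \<Rightarrow> real \<Rightarrow> real) \<Rightarrow> ('p \<Rightarrow> real \<Rightarrow> real) \<Rightarrow> real^'n \<Rightarrow> ereal" where
  "dual_obj A \<phi> g y =
     - convex_conjugate (separable g) (- (1 / real CARD('n)) *\<^sub>R (transpose A *v y))
     - ereal (1 / real CARD('n)) * (\<Sum>i\<in>UNIV. convex_conjugate (\<phi> i) (y $ i))"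

subsection \<open>The DSPDC algorithm\<close>

definition dual_update ::
  "real^'p^'n \<Rightarrow> ('n \<Rightarrow> real \<Rightarrow> real) \<Rightarrow> real \<Rightarrow> 'n set \<Rightarrow> real^'p \<Rightarrow> real^'n \<Rightarrow> real^'n" where
  "dual_update A \<phi> \<sigma> I xbar y =
     (\<chi> i. if i \<in> I
       then arg_max (\<lambda>\<beta>. ereal (1 / real CARD('n) * (row i A \<bullet> xbar) * \<beta>)
                        - convex_conjugate (\<phi> i) \<beta> / ereal (real CARD('n))
                        - ereal (1 / (2 * \<sigma>) * (\<beta> - y $ i)\<^sup>2)) (\<lambda>_. True)
       else y $ i)"

definition primal_update ::
  "real^'p^'n \<Rightarrow> ('p \<Rightarrow> real \<Rightarrow> real) \<Rightarrow> real \<Rightarrow> 'p set \<Rightarrow> real^'n \<Rightarrow> real^'p \<Rightarrow> real^'p" where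
  "primal_update A g \<tau> J ybar x =
     (\<chi> j. if j \<in> J
       then arg_min (\<lambda>\<alpha>. 1 / real CARD('n) * (column j A \<bullet> ybar) * \<alpha> + g j \<alpha>
                        + 1 / (2 * \<tau>) * (\<alpha> - x $ j)\<^sup>2) (\<lambda>_. True)
       else x $ j)"

text \<open>A state consists of \<open>x\<close>, its extrapolation \<open>xbar\<close>, and \<open>y\<close>. The extrapolation
  \<open>ybar\<close> is used only within the iteration that computes it, so it is not part of the state.\<close>

definition dspdc_step ::
  "real^'p^'n \<Rightarrow> ('n \<Rightarrow> real \<Rightarrow> real) \<Rightarrow> ('p \<Rightarrow> real \<Rightarrow> real) \<Rightarrow> nat \<Rightarrow> nat \<Rightarrow>
   real \<Rightarrow> real \<Rightarrow> real \<Rightarrow>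
   (real^'p) \<times> (real^'p) \<times> (real^'n) \<Rightarrow> ((real^'p) \<times> (real^'p) \<times> (real^'n)) pmf" where
  "dspdc_step A \<phi> g m q \<theta> \<tau> \<sigma> = (\<lambda>(x, xbar, y). do {
     I \<leftarrow> pmf_of_set {I :: 'n set. card I = m};
     J \<leftarrow> pmf_of_set {J :: 'p set. card J = q};
     let y' = dual_update A \<phi> \<sigma> I xbar y;
         ybar' = y + (real CARD('n) / real m) *\<^sub>R (y' - y);
         x' = primal_update A g \<tau> J ybar' x;
         xbar' = x + (\<theta> + 1) *\<^sub>R (x' - x)
     in return_pmf (x', xbar', y')
   })"

primrec dspdc ::
  "real^'p^'n \<Rightarrow> ('n \<Rightarrow> real \<Rightarrow> real) \<Rightarrow> ('p \<Rightarrow> real \<Rightarrow> real) \<Rightarrow> nat \<Rightarrow> nat \<Rightarrow>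
   real \<Rightarrow> real \<Rightarrow> real \<Rightarrow> real^'p \<Rightarrow> real^'n \<Rightarrow>
   nat \<Rightarrow> ((real^'p) \<times> (real^'p) \<times> (real^'n)) pmf" where
  "dspdc A \<phi> g m q \<theta> \<tau> \<sigma> x0 y0 0 = return_pmf (x0, x0, y0)"
| "dspdc A \<phi> g m q \<theta> \<tau> \<sigma> x0 y0 (Suc t) =
     bind_pmf (dspdc A \<phi> g m q \<theta> \<tau> \<sigma> x0 y0 t) (dspdc_step A \<phi> g m q \<theta> \<tau> \<sigma>)"

text \<open>The expectation of an extended real random variable is the expectation of its positive
  part minus that of its negative part (\<open>e2ennreal\<close> maps negative numbers to \<open>0\<close>).\<close>

definition ereal_expectation :: "'a pmf \<Rightarrow> ('a \<Rightarrow> ereal) \<Rightarrow> ereal" where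
  "ereal_expectation M f =
     enn2ereal (\<integral>\<^sup>+ s. e2ennreal (f s) \<partial>measure_pmf M)
     - enn2ereal (\<integral>\<^sup>+ s. e2ennreal (- f s) \<partial>measure_pmf M)"

end

theory Submission
  imports Defs
begin

text \<open>
  Let \<open>d\<close> be the last primal increment and \<open>G\<close>, \<open>H\<close> the primal and dual gaps of the Lagrangian at the
  saddle point. With \<open>r = p / q\<close> and \<open>s = n / m\<close>, the potential
  \<open>a |x - x*|^2 + b |y - y*|^2 + r G(x) + s H(y) + r / (4 \<tau>) |d|^2 + (r / n) <y - y*, A d>\<close>
  contracts in expectation by the factor \<open>\<rho> = \<theta> / r\<close> in every step. Each proximal update contributes
  a strong convexity inequality whose expectation over the random block is a statement about the
  full update. Adding the primal and the dual one leaves only the cross terms \<open><e, A d>\<close> and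
  \<open><e, A d'>\<close> of increments supported on blocks, which \<open>\<Lambda>\<close> controls and which the quadratic terms in
  the increments absorb. The term with the full vector \<open>y - y*\<close> is controlled by averaging over
  row blocks, so the potential dominates \<open>r G + s H\<close> and the squared distances. Finally
  \<open>P(x) - D(y) - G(x) - H(y)\<close> is bounded by the squared distances, because the \<open>\<phi> i\<close> and the conjugate
  of \<open>g\<close> are smooth.
\<close>

text \<open>The primal step uses an extrapolated \<open>y\<close> that already depends on the dual
  block, so the average over the primal block is taken first, with the dual block held fixed. The
  inner product in the potential has no sign, so it must reappear multiplied by exactly the
  contraction factor; this forces \<open>\<theta> = rho * rp\<close>. The extrapolation of
  \<open>y\<close> by \<open>rd\<close> cancels all products of the dual increment with
  \<open>x\<close> and \<open>xstar\<close>. The primal step yields \<open>rp / (2 * \<tau>)\<close>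
  times the squared increment. Half pays for the product with the current dual increment; the other
  half is stored in the potential and pays for the product with the next one. The dual quantity
  \<open>rd / (2 * \<sigma>)\<close> is halved between the same two products. The rule for
  \<open>\<tau> * \<sigma>\<close> is equality in the resulting weighted AM-GM condition, and the
  balance rule gives one bound \<open>R / 2\<close> that serves both the primal and the dual rate.
  Conjugates may be infinite. If the start has dual value minus infinity, the claimed bound is
  infinite; otherwise every iterate keeps a finite dual value and real arithmetic suffices.\<close>

lemma linear_coeff_eq_0:
  fixes k l :: real
  assumes "\<And>\<delta>. 0 \<le> k * \<delta> + l * \<delta>\<^sup>2"
  shows "k = 0"
proof (rule ccontr)
  assume k: "k \<noteq> 0"
  \<comment> \<open>Minimizer of \<open>k * \<delta> + w * \<delta>\<^sup>2\<close> with
    \<open>w = \<bar>l\<bar> + 1\<close>, which dominates \<open>l\<close> and is positive whatever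
    the sign of \<open>l\<close>.\<close>
  define e where "e = - k / (2 * (\<bar>l\<bar> + 1))"
  have "k * e + l * e\<^sup>2 \<le> k * e + (\<bar>l\<bar> + 1) * e\<^sup>2"
    by (intro add_left_mono mult_right_mono) auto
  also have "\<dots> = - k\<^sup>2 / (4 * (\<bar>l\<bar> + 1))"
  proof -
    have "k * (- k / (2 * w)) + w * (- k / (2 * w))\<^sup>2 = - k\<^sup>2 / (4 * w)" if "w > 0" for w
      using that by (simp add: field_simps power2_eq_square)
    from this[of "\<bar>l\<bar> + 1"] show ?thesis unfolding e_def by simp
  qed
  also have "\<dots> < 0" using k by (simp add: field_simps)
  finally show False using assms[of e] by simp
qed

text \<open>Replaces differentiation: a convexity inequality along a segment is divided by the step
  \<open>s\<close>, and the second-order remainder \<open>s * c\<close> then vanishes in the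
  limit.\<close>

lemma ge_if_ge_one_minus:
  fixes a b c :: real
  assumes "\<And>s. 0 < s \<Longrightarrow> s < 1 \<Longrightarrow> a \<ge> b - s * c"
  shows "a \<ge> b"
proof (rule tendsto_upperbound)
  show "((\<lambda>s. b - s * c) \<longlongrightarrow> b) (at_right 0)"
    by (auto intro!: tendsto_eq_intros)
  show "\<forall>\<^sub>F s in at_right 0. b - s * c \<le> a"
    using assms by (auto simp: eventually_at_right_field intro: exI[of _ 1])
qed simp

lemma quadratic_ge:
  fixes k c :: real
  assumes "k > 0"
  shows "k / 2 * x\<^sup>2 - c * x \<ge> - c\<^sup>2 / (2 * k)"
proof -
  have "k / 2 * x\<^sup>2 - c * x + c\<^sup>2 / (2 * k) = (k * x - c)\<^sup>2 / (2 * k)"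
    using assms by (simp add: field_simps power2_eq_square)
  also have "\<dots> \<ge> 0" using assms by simp
  finally show ?thesis by simp
qed

subsection \<open>Strongly convex functions and proximal steps\<close>

lemma strongly_convex_combination:
  assumes "strongly_convex \<mu> f" and "0 \<le> s" "s \<le> 1"
  shows "f ((1 - s) * a + s * b) \<le> (1 - s) * f a + s * f b - \<mu> / 2 * (s * (1 - s) * (b - a)\<^sup>2)"
proof -
  define z where "z = (1 - s) * a + s * b"
  obtain f' where f': "\<And>\<alpha> \<beta>. f \<alpha> \<ge> f \<beta> + f' \<beta> * (\<alpha> - \<beta>) + \<mu> / 2 * (\<alpha> - \<beta>)\<^sup>2"
    using assms(1) unfolding strongly_convex_def by auto
  have "(1 - s) * f a + s * f b \<ge> (1 - s) * (f z + f' z * (a - z) + \<mu> / 2 * (a - z)\<^sup>2)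
      + s * (f z + f' z * (b - z) + \<mu> / 2 * (b - z)\<^sup>2)"
    by (intro add_mono mult_left_mono f') (use assms in auto)
  also have "(1 - s) * (f z + f' z * (a - z) + \<mu> / 2 * (a - z)\<^sup>2)
      + s * (f z + f' z * (b - z) + \<mu> / 2 * (b - z)\<^sup>2) = f z + \<mu> / 2 * (s * (1 - s) * (b - a)\<^sup>2)"
  proof -
    have z: "a - z = - s * (b - a)" "b - z = (1 - s) * (b - a)"
      unfolding z_def by (simp_all add: algebra_simps)
    show ?thesis unfolding z by (simp add: field_simps power2_eq_square)
  qed
  finally show ?thesis unfolding z_def by simp
qed

text \<open>The definition gives the quadratic bound for one selection of subgradients. It is wanted
  for a particular one: 0 at a minimizer, or \<open>vdual ystar\<close> at \<open>xstar\<close>.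
  Comparing the subgradient bound with the strengthened chord inequality near \<open>a\<close>
  transfers it.\<close>

lemma strongly_convex_subgradient:
  assumes sc: "strongly_convex \<mu> f" and sub: "is_subgradient f a d"
  shows "f b \<ge> f a + d * (b - a) + \<mu> / 2 * (b - a)\<^sup>2"
proof (rule ge_if_ge_one_minus)
  fix s :: real assume s: "0 < s" "s < 1"
  have "f a + d * (((1 - s) * a + s * b) - a) \<le> f ((1 - s) * a + s * b)"
    using sub unfolding is_subgradient_def by simp
  also have "\<dots> \<le> (1 - s) * f a + s * f b - \<mu> / 2 * (s * (1 - s) * (b - a)\<^sup>2)"
    using strongly_convex_combination[OF sc, of s a b] s by simp
  finally have "s * (f a + d * (b - a) + \<mu> / 2 * (b - a)\<^sup>2 - s * (\<mu> / 2 * (b - a)\<^sup>2)) \<le> s * f b"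
    by (simp add: algebra_simps)
  then show "f a + d * (b - a) + \<mu> / 2 * (b - a)\<^sup>2 - s * (\<mu> / 2 * (b - a)\<^sup>2) \<le> f b"
    using s by simp
qed

lemma strongly_convex_continuous:
  assumes "strongly_convex \<mu> f" "\<mu> \<ge> 0"
  shows "continuous_on UNIV f"
proof (rule convex_on_continuous)
  show "convex_on UNIV f"
  proof (rule convex_onI)
    fix s x y :: real assume s: "0 < s" "s < 1"
    have "\<mu> / 2 * (s * (1 - s) * (y - x)\<^sup>2) \<ge> 0"
      using s assms by (intro mult_nonneg_nonneg) auto
    then show "f ((1 - s) *\<^sub>R x + s *\<^sub>R y) \<le> (1 - s) * f x + s * f y"
      using strongly_convex_combination[OF assms(1), of s x y] s by simp
  qed simp
qed simp

lemma strongly_convex_attains_min: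
  assumes sc: "strongly_convex \<mu> f" and mu: "\<mu> > 0"
  shows "\<exists>a. \<forall>b. f a \<le> f b"
proof -
  obtain f' where f': "\<And>\<alpha> \<beta>. f \<alpha> \<ge> f \<beta> + f' \<beta> * (\<alpha> - \<beta>) + \<mu> / 2 * (\<alpha> - \<beta>)\<^sup>2"
    using sc unfolding strongly_convex_def by auto
  \<comment> \<open>Beyond this radius the quadratic term outweighs the linear one, so
    \<open>f b \<ge> f 0\<close>.\<close>
  define r where "r = 2 * \<bar>f' 0\<bar> / \<mu>"
  have "r \<ge> 0" using mu unfolding r_def by simp
  have cont: "continuous_on {-r..r} f"
    using strongly_convex_continuous[OF sc] mu continuous_on_subset by fastforce
  have ne: "{-r..r} \<noteq> {}" using \<open>r \<ge> 0\<close> by simp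
  obtain a where a: "a \<in> {-r..r}" "\<And>b. b \<in> {-r..r} \<Longrightarrow> f a \<le> f b"
    using continuous_attains_inf[OF compact_Icc ne cont] by auto
  have "f a \<le> f b" for b
  proof (cases "b \<in> {-r..r}")
    case False
    then have b: "\<bar>b\<bar> > r" by auto
    have "2 * \<bar>f' 0\<bar> \<le> \<mu> * \<bar>b\<bar>" using b mu unfolding r_def by (simp add: field_simps)
    then have "2 * \<bar>f' 0\<bar> * \<bar>b\<bar> \<le> \<mu> * \<bar>b\<bar> * \<bar>b\<bar>" by (intro mult_right_mono) auto
    then have "\<bar>f' 0 * b\<bar> \<le> \<mu> / 2 * b\<^sup>2" by (simp add: abs_mult power2_eq_square)
    then have "f' 0 * b + \<mu> / 2 * b\<^sup>2 \<ge> 0" by linarith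
    then have "f 0 \<le> f b" using f'[of 0 b] by simp
    moreover have "f a \<le> f 0" using a(2) \<open>r \<ge> 0\<close> by simp
    ultimately show ?thesis by simp
  qed (use a in auto)
  then show ?thesis by blast
qed

lemma strongly_convex_prox:
  assumes "strongly_convex \<mu> f" and "\<mu> \<ge> 0" and "k > 0"
  shows "strongly_convex (\<mu> + k) (\<lambda>\<alpha>. c * \<alpha> + f \<alpha> + k / 2 * (\<alpha> - x)\<^sup>2)"
proof -
  obtain f' where f': "\<And>\<alpha> \<beta>. f \<alpha> \<ge> f \<beta> + f' \<beta> * (\<alpha> - \<beta>) + \<mu> / 2 * (\<alpha> - \<beta>)\<^sup>2"
    using assms unfolding strongly_convex_def by auto
  define h where "h \<beta> = c + f' \<beta> + k * (\<beta> - x)" for \<beta>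
  have *: "c * \<alpha> + f \<alpha> + k / 2 * (\<alpha> - x)\<^sup>2
      \<ge> (c * \<beta> + f \<beta> + k / 2 * (\<beta> - x)\<^sup>2) + h \<beta> * (\<alpha> - \<beta>) + (\<mu> + k) / 2 * (\<alpha> - \<beta>)\<^sup>2" for \<alpha> \<beta>
  proof -
    have "(c * \<beta> + f \<beta> + k / 2 * (\<beta> - x)\<^sup>2) + h \<beta> * (\<alpha> - \<beta>) + (\<mu> + k) / 2 * (\<alpha> - \<beta>)\<^sup>2
       = c * \<alpha> + (f \<beta> + f' \<beta> * (\<alpha> - \<beta>) + \<mu> / 2 * (\<alpha> - \<beta>)\<^sup>2) + k / 2 * (\<alpha> - x)\<^sup>2"
    proof -
      have "(c * \<beta> + v + K * (\<beta> - x)\<^sup>2) + (c + w + 2 * K * (\<beta> - x)) * (\<alpha> - \<beta>) + (M + K) * (\<alpha> - \<beta>)\<^sup>2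
        = c * \<alpha> + (v + w * (\<alpha> - \<beta>) + M * (\<alpha> - \<beta>)\<^sup>2) + K * (\<alpha> - x)\<^sup>2" for v w M K :: real
        by (simp add: algebra_simps power2_eq_square)
      from this[where M = "\<mu> / 2" and K = "k / 2"] show ?thesis
        unfolding h_def by (simp add: add_divide_distrib)
    qed
    with f'[where \<alpha>=\<alpha> and \<beta>=\<beta>] show ?thesis by linarith
  qed
  have pos: "(\<mu> + k) / 2 * (\<alpha> - \<beta>)\<^sup>2 \<ge> 0" for \<alpha> \<beta>
    using assms by simp
  show ?thesis
    unfolding strongly_convex_def is_subgradient_def
  proof (intro exI[of _ h] conjI allI)
    fix \<alpha> \<beta>
    show "c * \<alpha> + f \<alpha> + k / 2 * (\<alpha> - x)\<^sup>2
        \<ge> (c * \<beta> + f \<beta> + k / 2 * (\<beta> - x)\<^sup>2) + h \<beta> * (\<alpha> - \<beta>)"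
      using *[where \<alpha>=\<alpha> and \<beta>=\<beta>] pos[of \<alpha> \<beta>] by linarith
  qed (rule *)
qed

text \<open>The proximal objective is strongly convex with modulus \<open>\<mu> + 1 / \<tau>\<close>
  and has subgradient 0 at its minimizer.\<close>

lemma prox_gap:
  fixes c x :: real
  assumes sc: "strongly_convex \<mu> f" and "\<mu> \<ge> 0" "\<tau> > 0"
  defines "a \<equiv> arg_min (\<lambda>\<alpha>. c * \<alpha> + f \<alpha> + 1 / (2 * \<tau>) * (\<alpha> - x)\<^sup>2) (\<lambda>_. True)"
  shows "c * b + f b + 1 / (2 * \<tau>) * (b - x)\<^sup>2
      \<ge> c * a + f a + 1 / (2 * \<tau>) * (a - x)\<^sup>2 + (1 / (2 * \<tau>) + \<mu> / 2) * (b - a)\<^sup>2"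
proof -
  define F where "F = (\<lambda>\<alpha>. c * \<alpha> + f \<alpha> + 1 / (2 * \<tau>) * (\<alpha> - x)\<^sup>2)"
  have F: "strongly_convex (\<mu> + 1 / \<tau>) F"
    using strongly_convex_prox[OF sc, of "1 / \<tau>" c x] assms(2,3) unfolding F_def
    by (simp add: mult.commute[of 2])
  have "\<mu> + 1 / \<tau> > 0" using assms by (intro add_nonneg_pos) auto
  from strongly_convex_attains_min[OF F this] obtain a' where a': "\<And>b. F a' \<le> F b"
    by blast
  \<comment> \<open>\<open>arg_min\<close> chooses some minimizer, so only the attained value is
    compared.\<close>
  have "F a = F a'"
    unfolding a_def F_def[symmetric] by (rule arg_min_equality) (use a' in auto)
  then have "is_subgradient F a 0" unfolding is_subgradient_def using a' by simp
  from strongly_convex_subgradient[OF F this, of b]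
  show ?thesis unfolding F_def by (simp add: add_divide_distrib add.commute mult.commute[of 2])
qed

subsection \<open>Conjugates of smooth functions\<close>

lemma smooth_bound:
  assumes "smooth L f"
  shows "f \<alpha> \<le> f \<beta> + deriv f \<beta> * (\<alpha> - \<beta>) + L / 2 * (\<alpha> - \<beta>)\<^sup>2"
  using assms unfolding smooth_def by simp

lemma smooth_convex_deriv_subgradient:
  assumes "smooth L f" "convex_on UNIV f"
  shows "is_subgradient f \<beta> (deriv f \<beta>)"
  unfolding is_subgradient_def
proof
  fix \<alpha>
  have "(f has_real_derivative deriv f \<beta>) (at \<beta>)"
    using assms(1) by (simp add: smooth_def DERIV_deriv_iff_real_differentiable)
  then have "f \<alpha> - f \<beta> \<ge> deriv f \<beta> * (\<alpha> - \<beta>)"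
    by (intro convex_on_imp_above_tangent[OF assms(2)]) auto
  then show "f \<alpha> \<ge> f \<beta> + deriv f \<beta> * (\<alpha> - \<beta>)" by simp
qed

text \<open>The smoothness bound minus the subgradient bound is a nonnegative quadratic without
  constant term, so its linear coefficient vanishes.\<close>

lemma smooth_subgradient_eq_deriv:
  assumes "smooth L f" "is_subgradient f \<beta> d"
  shows "d = deriv f \<beta>"
proof -
  have "0 \<le> (deriv f \<beta> - d) * \<delta> + L / 2 * \<delta>\<^sup>2" for \<delta>
  proof -
    have "f \<beta> + d * \<delta> \<le> f (\<beta> + \<delta>)"
      using assms(2) unfolding is_subgradient_def by (metis add_diff_cancel_left')
    also have "\<dots> \<le> f \<beta> + deriv f \<beta> * \<delta> + L / 2 * \<delta>\<^sup>2"
      using smooth_bound[OF assms(1), of "\<beta> + \<delta>" \<beta>] by simp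
    finally show ?thesis by (simp add: algebra_simps)
  qed
  then show ?thesis using linear_coeff_eq_0 by fastforce
qed

lemma convex_conjugate_ge:
  "convex_conjugate f v \<ge> ereal (u \<bullet> v - f u)"
  unfolding convex_conjugate_def by (intro SUP_upper) simp

lemma convex_conjugate_at_subgradient:
  assumes "is_subgradient f u \<beta>"
  shows "convex_conjugate f \<beta> = ereal (\<beta> * u - f u)"
proof (rule antisym)
  show "convex_conjugate f \<beta> \<le> ereal (\<beta> * u - f u)"
    unfolding convex_conjugate_def
  proof (rule SUP_least)
    fix w :: real
    have "f w \<ge> f u + \<beta> * (w - u)" using assms unfolding is_subgradient_def by simp
    then show "ereal (w \<bullet> \<beta> - f w) \<le> ereal (\<beta> * u - f u)" by (simp add: algebra_simps)
  qed
  show "ereal (\<beta> * u - f u) \<le> convex_conjugate f \<beta>"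
    using convex_conjugate_ge[of u \<beta> f] by (simp add: mult.commute)
qed

text \<open>Evaluate the supremum at \<open>u + \<gamma> (\<beta> - f' u)\<close>, which maximizes the lower bound given by
  smoothness.\<close>

lemma convex_conjugate_smooth_ge:
  assumes "smooth (1 / \<gamma>) f" "\<gamma> > 0"
  shows "convex_conjugate f \<beta> \<ge> ereal (\<beta> * u - f u + \<gamma> / 2 * (\<beta> - deriv f u)\<^sup>2)"
proof -
  define v where "v = u + \<gamma> * (\<beta> - deriv f u)"
  have "f v \<le> f u + deriv f u * (v - u) + 1 / \<gamma> / 2 * (v - u)\<^sup>2"
    by (rule smooth_bound[OF assms(1)])
  also have "1 / \<gamma> / 2 * (v - u)\<^sup>2 = \<gamma> / 2 * (\<beta> - deriv f u)\<^sup>2"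
    using assms(2) unfolding v_def by (simp add: power2_eq_square)
  finally have "\<beta> * u - f u + \<gamma> / 2 * (\<beta> - deriv f u)\<^sup>2 \<le> v * \<beta> - f v"
    unfolding v_def by (simp add: power2_eq_square algebra_simps)
  then have "ereal (\<beta> * u - f u + \<gamma> / 2 * (\<beta> - deriv f u)\<^sup>2) \<le> ereal (v \<bullet> \<beta> - f v)"
    by simp
  also have "\<dots> \<le> convex_conjugate f \<beta>" by (rule convex_conjugate_ge)
  finally show ?thesis .
qed

text \<open>The equation is stationarity of a proximal problem for \<open>f\<close>, with center
  \<open>c\<close> and tilt \<open>y\<close>. Working on this side avoids minimizing an
  extended-valued conjugate.\<close>

lemma smooth_convex_prox_point:
  assumes sm: "smooth L f" and cv: "convex_on UNIV f" and k: "k > 0"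
  shows "\<exists>u. deriv f u = y + k * (c - u)"
proof -
  \<comment> \<open>Convexity is strong convexity of modulus 0; the proximal term alone supplies the
    positive modulus.\<close>
  have "strongly_convex 0 f"
    unfolding strongly_convex_def
    using smooth_convex_deriv_subgradient[OF sm cv] by (auto simp: is_subgradient_def)
  then have "strongly_convex k (\<lambda>\<alpha>. (-y) * \<alpha> + f \<alpha> + k / 2 * (\<alpha> - c)\<^sup>2)"
    using strongly_convex_prox[of 0 f k "-y" c] k by simp
  from strongly_convex_attains_min[OF this k] obtain u where
    u: "\<And>b. (-y) * u + f u + k / 2 * (u - c)\<^sup>2 \<le> (-y) * b + f b + k / 2 * (b - c)\<^sup>2"
    by blast
  have "0 \<le> (deriv f u - y + k * (u - c)) * \<delta> + (L / 2 + k / 2) * \<delta>\<^sup>2" for \<delta>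
  proof -
    have "(-y) * u + f u + k / 2 * (u - c)\<^sup>2
        \<le> (-y) * (u + \<delta>) + f (u + \<delta>) + k / 2 * (u + \<delta> - c)\<^sup>2" by (rule u)
    also have "f (u + \<delta>) \<le> f u + deriv f u * \<delta> + L / 2 * \<delta>\<^sup>2"
      using smooth_bound[OF sm, of "u + \<delta>" u] by simp
    finally show ?thesis by (simp add: power2_eq_square algebra_simps)
  qed
  then have "deriv f u - y + k * (u - c) = 0" by (rule linear_coeff_eq_0)
  then show ?thesis by (intro exI[of _ u]) (simp add: algebra_simps)
qed

text \<open>By Moreau's identity the dual proximal point is the derivative of \<open>f\<close> at a primal one.\<close>

lemma conjugate_prox:
  fixes c y :: real
  assumes sm: "smooth (1 / \<gamma>) f" and cv: "convex_on UNIV f"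
    and pos: "\<gamma> > 0" "\<sigma> > 0" "N > 0"
  defines "F \<equiv> \<lambda>\<beta>. ereal (1 / N * c * \<beta>) - convex_conjugate f \<beta> / ereal N
                 - ereal (1 / (2 * \<sigma>) * (\<beta> - y)\<^sup>2)"
  obtains \<beta> r where "arg_max F (\<lambda>_. True) = \<beta>"
    "convex_conjugate f \<beta> = ereal r"
    "\<forall>b s. convex_conjugate f b = ereal s \<longrightarrow>
       - (c / N) * b + s / N + 1 / (2 * \<sigma>) * (b - y)\<^sup>2
       \<ge> - (c / N) * \<beta> + r / N + 1 / (2 * \<sigma>) * (\<beta> - y)\<^sup>2 + (1 / (2 * \<sigma>) + \<gamma> / N / 2) * (b - \<beta>)\<^sup>2"
proof -
  \<comment> \<open>With weight \<open>\<sigma> / N\<close> this is the stationarity condition of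
    the dual proximal problem, \<open>u\<close> playing the role of a subgradient of the conjugate
    at \<open>\<beta>\<close>.\<close>
  obtain u where u: "deriv f u = y + \<sigma> / N * (c - u)"
    using smooth_convex_prox_point[OF sm cv, of "\<sigma> / N"] pos by auto
  define \<beta> where "\<beta> = deriv f u"
  define r where "r = \<beta> * u - f u"
  have conj: "convex_conjugate f \<beta> = ereal r"
    unfolding r_def \<beta>_def
    by (rule convex_conjugate_at_subgradient[OF smooth_convex_deriv_subgradient[OF sm cv]])
  have gap: "- (c / N) * b + s / N + 1 / (2 * \<sigma>) * (b - y)\<^sup>2
       \<ge> - (c / N) * \<beta> + r / N + 1 / (2 * \<sigma>) * (\<beta> - y)\<^sup>2 + (1 / (2 * \<sigma>) + \<gamma> / N / 2) * (b - \<beta>)\<^sup>2"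
    if "convex_conjugate f b = ereal s" for b s
  proof -
    have s: "s \<ge> b * u - f u + \<gamma> / 2 * (b - \<beta>)\<^sup>2"
      using convex_conjugate_smooth_ge[OF sm, of b u] pos that unfolding \<beta>_def by simp
    have "- (c / N) * b + s / N + 1 / (2 * \<sigma>) * (b - y)\<^sup>2
        \<ge> - (c / N) * b + (b * u - f u + \<gamma> / 2 * (b - \<beta>)\<^sup>2) / N + 1 / (2 * \<sigma>) * (b - y)\<^sup>2"
      using divide_right_mono[OF s, of N] pos by simp
    \<comment> \<open>The minorant of the conjugate makes the objective an exact quadratic in
      \<open>b\<close>. Its leading coefficient is
      \<open>1 / (2 * \<sigma>) + \<gamma> / N / 2\<close>, and the equation for \<open>u\<close>
      makes it stationary at \<open>\<beta>\<close>.\<close>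
    moreover have "- (c / N) * b + (b * u - f u + \<gamma> / 2 * (b - \<beta>)\<^sup>2) / N + 1 / (2 * \<sigma>) * (b - y)\<^sup>2
      = - (c / N) * \<beta> + r / N + 1 / (2 * \<sigma>) * (\<beta> - y)\<^sup>2 + (1 / (2 * \<sigma>) + \<gamma> / N / 2) * (b - \<beta>)\<^sup>2"
    proof -
      have e: "\<gamma> * inverse N / 2 = \<gamma> / 2 * inverse N" by simp
      have c: "c / N = u * inverse N + 2 * (1 / (2 * \<sigma>)) * (\<beta> - y)"
      proof -
        have "\<beta> - y = \<sigma> * ((c - u) / N)" using u unfolding \<beta>_def by simp
        then have "2 * (1 / (2 * \<sigma>)) * (\<beta> - y) = (c - u) / N" using pos by simp
        then show ?thesis by (simp add: diff_divide_distrib flip: divide_inverse)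
      qed
      have "- (u * K + 2 * S * (\<beta> - y)) * b + (b * u - f u + G * (b - \<beta>)\<^sup>2) * K + S * (b - y)\<^sup>2
        = - (u * K + 2 * S * (\<beta> - y)) * \<beta> + (\<beta> * u - f u) * K + S * (\<beta> - y)\<^sup>2
          + (S + G * K) * (b - \<beta>)\<^sup>2" for K S G
        by (simp add: algebra_simps power2_eq_square)
      from this[of "inverse N" "1 / (2 * \<sigma>)" "\<gamma> / 2"] show ?thesis
        unfolding r_def divide_inverse[of _ N] c[unfolded divide_inverse[of _ N]] e .
    qed
    ultimately show ?thesis by linarith
  qed
  \<comment> \<open>Uniqueness of the maximizer is what identifies the choice made by
    \<open>arg_max\<close>; points with infinite conjugate have value minus infinity.\<close>
  have strict: "F b < F \<beta>" if "b \<noteq> \<beta>" for b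
  proof (cases "convex_conjugate f b")
    case (real s)
    have "(1 / (2 * \<sigma>) + \<gamma> / N / 2) * (b - \<beta>)\<^sup>2 > 0"
      using pos that by (intro mult_pos_pos add_pos_pos) auto
    moreover have "1 / N * c * b = c / N * b" "1 / N * c * \<beta> = c / N * \<beta>" by simp_all
    ultimately have "1 / N * c * b - s / N - 1 / (2 * \<sigma>) * (b - y)\<^sup>2
        < 1 / N * c * \<beta> - r / N - 1 / (2 * \<sigma>) * (\<beta> - y)\<^sup>2"
      using gap[OF real] by linarith
    then show ?thesis unfolding F_def real conj using pos by simp
  next
    case PInf
    then show ?thesis unfolding F_def conj using pos by simp
  next
    case MInf
    then show ?thesis using convex_conjugate_ge[of 0 b f] by simp
  qed
  have "is_arg_max F (\<lambda>_. True) (arg_max F (\<lambda>_. True))"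
    unfolding arg_max_def
  proof (rule someI[where x = \<beta>])
    show "is_arg_max F (\<lambda>_. True) \<beta>"
      unfolding is_arg_max_def using strict by (metis less_asym less_irrefl)
  qed
  then have "arg_max F (\<lambda>_. True) = \<beta>"
    unfolding is_arg_max_def using strict by auto
  then show ?thesis using conj gap that by blast
qed

subsection \<open>Uniformly random subsets of fixed size\<close>

lemma card_subsets_of_size:
  "card {I :: 'k::finite set. card I = k} = CARD('k) choose k"
  using n_subsets[of "UNIV :: 'k set" k] by simp

lemma subsets_of_size_nonempty:
  assumes "k \<le> CARD('k::finite)"
  shows "{I :: 'k set. card I = k} \<noteq> {}"
proof
  assume "{I :: 'k set. card I = k} = {}"
  then have "CARD('k) choose k = 0" using card_subsets_of_size[where ?'k='k, of k] by simp
  with assms show False by (simp add: binomial_eq_0_iff)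
qed

lemma set_pmf_subsets_of_size:
  assumes "k \<le> CARD('k::finite)"
  shows "set_pmf (pmf_of_set {I :: 'k set. card I = k}) = {I. card I = k}"
  using subsets_of_size_nonempty[OF assms] by (intro set_pmf_of_set) auto

lemma card_subsets_of_size_notin:
  fixes i :: "'k::finite"
  assumes "k \<le> CARD('k)"
  shows "real CARD('k) * real (card {I :: 'k set. card I = k \<and> i \<notin> I})
    = (real CARD('k) - real k) * real (CARD('k) choose k)"
proof -
  have "{I :: 'k set. card I = k \<and> i \<notin> I} = {I. I \<subseteq> UNIV - {i} \<and> card I = k}" by auto
  then have "card {I :: 'k set. card I = k \<and> i \<notin> I} = (CARD('k) - 1) choose k"
    using n_subsets[of "UNIV - {i}" k] by (simp add: card_Diff_singleton)
  moreover have "(CARD('k) - k) * (CARD('k) choose k) = CARD('k) * ((CARD('k) - 1) choose k)"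
    by (rule binomial_absorb_comp)
  ultimately show ?thesis
    using assms by (metis of_nat_diff of_nat_mult)
qed

text \<open>The integrand is a sum over coordinates, so only the marginal inclusion probability
  enters, not the dependence between the members of \<open>I\<close>.\<close>

lemma expectation_random_subset:
  fixes a b :: "'k::finite \<Rightarrow> real"
  assumes "k \<le> CARD('k)"
  shows "measure_pmf.expectation (pmf_of_set {I :: 'k set. card I = k})
           (\<lambda>I. \<Sum>i\<in>UNIV. if i \<in> I then a i else b i)
    = (\<Sum>i\<in>UNIV. real k / real CARD('k) * a i + (1 - real k / real CARD('k)) * b i)"
proof -
  define S where "S = {I :: 'k set. card I = k}"
  define C where "C = real (CARD('k) choose k)"
  have C: "real (card S) = C" unfolding S_def C_def by (simp add: card_subsets_of_size)
  have C0: "C > 0" unfolding C_def using assms by (simp add: zero_less_binomial)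
  have one: "(\<Sum>I\<in>S. if i \<in> I then a i else b i)
      = C * (real k / real CARD('k) * a i + (1 - real k / real CARD('k)) * b i)" for i
  proof -
    have nin: "real (card (S \<inter> {I. i \<notin> I})) = (1 - real k / real CARD('k)) * C"
    proof -
      have "S \<inter> {I. i \<notin> I} = {I. card I = k \<and> i \<notin> I}" unfolding S_def by auto
      then show ?thesis
        using card_subsets_of_size_notin[OF assms, of i] unfolding C_def by (simp add: field_simps)
    qed
    have "card S = card (S \<inter> {I. i \<in> I}) + card (S \<inter> {I. i \<notin> I})"
      by (subst card_Un_disjoint[symmetric]) (auto intro: arg_cong[where f = card])
    then have "real (card (S \<inter> {I. i \<in> I})) = real k / real CARD('k) * C"
      using C nin by (simp add: algebra_simps)
    moreover have "(\<Sum>I\<in>S. if i \<in> I then a i else b i)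
      = real (card (S \<inter> {I. i \<in> I})) * a i + real (card (S \<inter> {I. i \<notin> I})) * b i"
      by (subst sum.If_cases) (auto simp: Compl_eq)
    ultimately show ?thesis using nin by (simp add: algebra_simps)
  qed
  have "measure_pmf.expectation (pmf_of_set S) (\<lambda>I. \<Sum>i\<in>UNIV. if i \<in> I then a i else b i)
    = (\<Sum>I\<in>S. \<Sum>i\<in>UNIV. if i \<in> I then a i else b i) / C"
    using subsets_of_size_nonempty[OF assms] C unfolding S_def by (subst integral_pmf_of_set) auto
  also have "\<dots> = (\<Sum>i\<in>UNIV. \<Sum>I\<in>S. if i \<in> I then a i else b i) / C"
    by (subst sum.swap) simp
  also have "\<dots> = (\<Sum>i\<in>UNIV. real k / real CARD('k) * a i + (1 - real k / real CARD('k)) * b i)"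
    using C0 by (simp only: one flip: sum_distrib_left) simp
  finally show ?thesis unfolding S_def .
qed

lemma norm_power2_vec: "(norm (x :: real^'k))\<^sup>2 = (\<Sum>i\<in>UNIV. (x $ i)\<^sup>2)"
  unfolding power2_norm_eq_inner by (simp add: inner_vec_def power2_eq_square)

text \<open>A coordinate is updated with
  probability \<open>1 / r\<close>, and extrapolating by the factor \<open>r\<close> makes the step unbiased.\<close>

lemma random_prox_gap:
  fixes old new z w :: "real^'k" and \<psi> :: "'k \<Rightarrow> real \<Rightarrow> real"
  assumes k: "0 < k" "k \<le> CARD('k)"
    and gap: "\<And>i. w $ i * z $ i + \<psi> i (z $ i) + 1 / (2 * \<tau>) * (z $ i - old $ i)\<^sup>2
      \<ge> w $ i * new $ i + \<psi> i (new $ i) + 1 / (2 * \<tau>) * (new $ i - old $ i)\<^sup>2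
         + (1 / (2 * \<tau>) + \<mu> / 2) * (z $ i - new $ i)\<^sup>2"
  defines "r \<equiv> real CARD('k) / real k"
    and "u \<equiv> \<lambda>I. \<chi> i. if i \<in> I then new $ i else old $ i"
  defines "a \<equiv> r / (2 * \<tau>) + r * \<mu> / 2"
  shows "0 \<le> measure_pmf.expectation (pmf_of_set {I :: 'k set. card I = k})
    (\<lambda>I. w \<bullet> (z - (old + r *\<^sub>R (u I - old))) + separable \<psi> z - r * separable \<psi> (u I)
       + (r - 1) * separable \<psi> old - r / (2 * \<tau>) * (norm (u I - old))\<^sup>2
       - a * (norm (u I - z))\<^sup>2 + (a - \<mu> / 2) * (norm (old - z))\<^sup>2)"
proof -
  define f where "f i v = w $ i * (z $ i - (old $ i + r * (v - old $ i))) + \<psi> i (z $ i) - r * \<psi> i v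
       + (r - 1) * \<psi> i (old $ i) - r / (2 * \<tau>) * (v - old $ i)\<^sup>2
       - a * (v - z $ i)\<^sup>2 + (a - \<mu> / 2) * (old $ i - z $ i)\<^sup>2" for i v
  have r: "r > 0" using k unfolding r_def by simp
  have kr: "real k / real CARD('k) = 1 / r" using k unfolding r_def by simp
  have eq: "w \<bullet> (z - (old + r *\<^sub>R (u I - old))) + separable \<psi> z - r * separable \<psi> (u I)
       + (r - 1) * separable \<psi> old - r / (2 * \<tau>) * (norm (u I - old))\<^sup>2
       - a * (norm (u I - z))\<^sup>2 + (a - \<mu> / 2) * (norm (old - z))\<^sup>2
     = (\<Sum>i\<in>UNIV. if i \<in> I then f i (new $ i) else f i (old $ i))" for I
  proof -
    have "(if i \<in> I then f i (new $ i) else f i (old $ i)) = f i (u I $ i)" for i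
      unfolding u_def by simp
    then show ?thesis
      by (simp add: f_def norm_power2_vec inner_vec_def separable_def sum.distrib
          sum_subtractf sum_distrib_left)
  qed
  \<comment> \<open>With \<open>T = 1 / (2 * \<tau>)\<close> and \<open>M = \<mu> / 2\<close>, the
    coefficient of the old distance is \<open>T + (r - 1) * (T + M) = r * (T + M) - M\<close>, which
    explains \<open>a - \<mu> / 2\<close>.\<close>
  have "real k / real CARD('k) * f i (new $ i) + (1 - real k / real CARD('k)) * f i (old $ i) \<ge> 0" for i
  proof -
    have "(1 / r) * f i (new $ i) + (1 - 1 / r) * f i (old $ i)
      = w $ i * z $ i + \<psi> i (z $ i) + 1 / (2 * \<tau>) * (z $ i - old $ i)\<^sup>2
      - (w $ i * new $ i + \<psi> i (new $ i) + 1 / (2 * \<tau>) * (new $ i - old $ i)\<^sup>2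
         + (1 / (2 * \<tau>) + \<mu> / 2) * (z $ i - new $ i)\<^sup>2)"
    proof -
      have id: "(1 / r) * (W * (Z - (Y + r * (V - Y))) + PZ - r * PV + (r - 1) * PY - r * T * (V - Y)\<^sup>2
         - r * (T + M) * (V - Z)\<^sup>2 + (r * (T + M) - M) * (Y - Z)\<^sup>2)
         + (1 - 1 / r) * (W * (Z - (Y + r * (Y - Y))) + PZ - r * PY + (r - 1) * PY - r * T * (Y - Y)\<^sup>2
         - r * (T + M) * (Y - Z)\<^sup>2 + (r * (T + M) - M) * (Y - Z)\<^sup>2)
         = W * Z + PZ + T * (Z - Y)\<^sup>2 - (W * V + PV + T * (V - Y)\<^sup>2 + (T + M) * (Z - V)\<^sup>2)"
        (is "1 / r * ?fV + (1 - 1 / r) * ?fY = ?rhs") for W Z Y V PZ PV PY T M :: real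
      proof -
        \<comment> \<open>The two values differ by \<open>r * D\<close>, so the weight
          \<open>1 / r\<close> cancels and a polynomial identity remains.\<close>
        define D where "D = - W * (V - Y) - PV + PY - T * (V - Y)\<^sup>2
          - (T + M) * (V - Z)\<^sup>2 + (T + M) * (Y - Z)\<^sup>2"
        have fY: "?fY = W * (Z - Y) + PZ - PY - M * (Y - Z)\<^sup>2"
          by (simp add: algebra_simps power2_eq_square)
        have "?fV = ?fY + r * D"
          unfolding D_def by (simp add: algebra_simps power2_eq_square)
        then have "1 / r * ?fV + (1 - 1 / r) * ?fY = ?fY + (1 / r * r) * D"
          by (simp only: distrib_left left_diff_distrib mult.assoc) simp
        also have "\<dots> = ?rhs"
          unfolding fY D_def using r by (simp add: algebra_simps power2_eq_square)
        finally show ?thesis .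
      qed
      have a: "a = r * (1 / (2 * \<tau>) + \<mu> / 2)" "r / (2 * \<tau>) = r * (1 / (2 * \<tau>))"
        unfolding a_def by (simp_all add: algebra_simps)
      show ?thesis
        unfolding f_def a by (rule id)
    qed
    with gap[of i] show ?thesis unfolding kr by linarith
  qed
  then show ?thesis
    unfolding eq expectation_random_subset[OF k(2)] by (intro sum_nonneg) auto
qed

subsection \<open>Saddle points\<close>

lemma row_inner_eq: "row i A \<bullet> x = (A *v x) $ i" for A :: "real^'p^'n"
  by (simp add: row_def inner_vec_def matrix_vector_mult_def)

lemma column_inner_eq: "column j A \<bullet> y = (transpose A *v y) $ j" for A :: "real^'p^'n"
  by (simp add: column_def transpose_def inner_vec_def matrix_vector_mult_def)

lemma transpose_inner: "(transpose A *v y) \<bullet> x = y \<bullet> (A *v x)" for A :: "real^'p^'n"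
  by (simp add: dot_lmul_matrix flip: vector_transpose_matrix)

lemma separable_update:
  "separable g (x + c *\<^sub>R axis j 1) = separable g x - g j (x $ j) + g j (x $ j + c)"
proof -
  have "separable g (x + c *\<^sub>R axis j 1)
      = g j (x $ j + c) + (\<Sum>i\<in>UNIV - {j}. g i (x $ i))"
    unfolding separable_def by (subst sum.remove[of _ j]) (auto simp: axis_def)
  moreover have "separable g x = g j (x $ j) + (\<Sum>i\<in>UNIV - {j}. g i (x $ i))"
    unfolding separable_def by (rule sum.remove) auto
  ultimately show ?thesis by simp
qed

lemma convex_conjugate_not_MInf: "convex_conjugate f v \<noteq> -\<infinity>"
  using convex_conjugate_ge[of undefined v f] by auto

text \<open>Quantitative form of the fact that the conjugate of a \<open>\<mu>\<close>-strongly
  convex function is \<open>1 / \<mu>\<close>-smooth, expanded at \<open>w\<close>, where the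
  gradient of the conjugate is \<open>x\<close>. At \<open>v = w\<close> the remainder
  vanishes.\<close>

lemma convex_conjugate_separable_le:
  assumes "\<And>j. strongly_convex \<mu> (g j)" and "\<mu> > 0"
    and sub: "\<And>j. is_subgradient (g j) (x $ j) (w $ j)"
  shows "convex_conjugate (separable g) v
    \<le> ereal (x \<bullet> v - separable g x + (norm (v - w))\<^sup>2 / (2 * \<mu>))"
  unfolding convex_conjugate_def
proof (rule SUP_least)
  fix u
  have "(\<Sum>j\<in>UNIV. u $ j * v $ j - g j (u $ j))
    \<le> (\<Sum>j\<in>UNIV. x $ j * v $ j - g j (x $ j) + (v $ j - w $ j)\<^sup>2 / (2 * \<mu>))"
  proof (rule sum_mono)
    fix j
    have "g j (u $ j) \<ge> g j (x $ j) + w $ j * (u $ j - x $ j) + \<mu> / 2 * (u $ j - x $ j)\<^sup>2"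
      by (rule strongly_convex_subgradient[OF assms(1) sub])
    moreover have "\<mu> / 2 * (u $ j - x $ j)\<^sup>2 - (v $ j - w $ j) * (u $ j - x $ j)
        \<ge> - (v $ j - w $ j)\<^sup>2 / (2 * \<mu>)"
      by (rule quadratic_ge[OF assms(2)])
    ultimately show "u $ j * v $ j - g j (u $ j)
        \<le> x $ j * v $ j - g j (x $ j) + (v $ j - w $ j)\<^sup>2 / (2 * \<mu>)"
      by (simp add: algebra_simps)
  qed
  then show "ereal (u \<bullet> v - separable g u)
      \<le> ereal (x \<bullet> v - separable g x + (norm (v - w))\<^sup>2 / (2 * \<mu>))"
    by (simp add: inner_vec_def separable_def norm_power2_vec sum_subtractf sum.distrib
        sum_divide_distrib)
qed

text \<open>The two optimizers are assumed separately; the saddle point relations between them are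
  derived below.\<close>

locale saddle_problem =
  fixes A :: "real^'p^'n" and \<phi> :: "'n \<Rightarrow> real \<Rightarrow> real" and g :: "'p \<Rightarrow> real \<Rightarrow> real"
    and n lam \<gamma> :: real and xstar :: "real^'p" and ystar :: "real^'n"
  assumes n: "n = real CARD('n)" and lam: "lam > 0" and gam: "\<gamma> > 0"
    and g_sc: "\<And>j. strongly_convex lam (g j)"
    and \<phi>_convex: "\<And>i. convex_on UNIV (\<phi> i)"
    and \<phi>_smooth: "\<And>i. smooth (1 / \<gamma>) (\<phi> i)"
    and xstar: "is_arg_min (primal_obj A \<phi> g) (\<lambda>_. True) xstar"
    and ystar: "is_arg_max (dual_obj A \<phi> g) (\<lambda>_. True) ystar"
begin

text \<open>\<open>real_of_ereal\<close> sends infinite values to 0, so this represents the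
  conjugate only where it is finite; statements about it therefore ask for
  \<open>y \<in> dom\<close>.\<close>

definition conj_real :: "'n \<Rightarrow> real \<Rightarrow> real" where
  "conj_real i \<beta> = real_of_ereal (convex_conjugate (\<phi> i) \<beta>)"

definition dom :: "(real^'n) set" where
  "dom = {y. \<forall>i. convex_conjugate (\<phi> i) (y $ i) \<noteq> \<infinity>}"

definition h :: "real^'n \<Rightarrow> real" where
  "h = separable (\<lambda>i \<beta>. conj_real i \<beta> / n)"

definition vdual :: "real^'n \<Rightarrow> real^'p" where
  "vdual y = - (1 / n) *\<^sub>R (transpose A *v y)"

lemma vdual_inner: "x \<bullet> vdual y = - (1 / n) * (y \<bullet> (A *v x))"
  unfolding vdual_def by (simp add: inner_commute[of x] dot_lmul_matrix)

lemma vdual_diff: "vdual y - vdual z = vdual (y - z)"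
  unfolding vdual_def by (simp add: matrix_vector_mult_diff_distrib scaleR_diff_right)

lemma conj_real: "convex_conjugate (\<phi> i) (y $ i) = ereal (conj_real i (y $ i))" if "y \<in> dom"
  using that convex_conjugate_not_MInf[of "\<phi> i" "y $ i"]
  unfolding dom_def conj_real_def by (cases "convex_conjugate (\<phi> i) (y $ i)") auto

lemma conj_real_ge: "y $ i * z - \<phi> i z \<le> conj_real i (y $ i)" if "y \<in> dom"
  using convex_conjugate_ge[of z "y $ i" "\<phi> i"] unfolding conj_real[OF that]
  by (simp add: mult.commute)

lemma n_pos: "n > 0"
  by (simp add: n)

lemma h_sum: "h y = 1 / n * (\<Sum>i\<in>UNIV. conj_real i (y $ i))"
  unfolding h_def separable_def by (simp add: sum_divide_distrib)

lemma dual_obj_dom: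
  assumes "y \<in> dom"
  shows "dual_obj A \<phi> g y = - convex_conjugate (separable g) (vdual y) - ereal (h y)"
  unfolding dual_obj_def vdual_def h_sum n[symmetric] by (simp add: conj_real[OF assms])

lemma dual_obj_not_dom:
  assumes "y \<notin> dom"
  shows "dual_obj A \<phi> g y = -\<infinity>"
proof -
  have "(\<Sum>i\<in>UNIV. convex_conjugate (\<phi> i) (y $ i)) = \<infinity>"
    using assms unfolding dom_def by (subst sum_Pinfty) auto
  then have prod: "ereal (1 / n) * (\<Sum>i\<in>UNIV. convex_conjugate (\<phi> i) (y $ i)) = \<infinity>"
    using n_pos by simp
  have minf: "- c - \<infinity> = -\<infinity>" if "c \<noteq> -\<infinity>" for c :: ereal
    using that by (cases c) auto
  show ?thesis
    unfolding dual_obj_def n[symmetric] prod by (rule minf[OF convex_conjugate_not_MInf])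
qed

lemma primal_obj_alt:
  "primal_obj A \<phi> g x = 1 / n * (\<Sum>i\<in>UNIV. \<phi> i ((A *v x) $ i)) + separable g x"
  unfolding primal_obj_def row_inner_eq n ..

section \<open>Optimality conditions and strong duality\<close>

definition yhat :: "real^'n" where
  "yhat = (\<chi> i. deriv (\<phi> i) ((A *v xstar) $ i))"

lemma yhat_subgradient: "is_subgradient (\<phi> i) ((A *v xstar) $ i) (yhat $ i)"
  unfolding yhat_def by (simp add: smooth_convex_deriv_subgradient[OF \<phi>_smooth \<phi>_convex])

text \<open>First-order optimality along coordinate \<open>j\<close>: moving \<open>xstar\<close> by
  the fraction \<open>s\<close> towards \<open>u\<close> changes the losses linearly up to
  \<open>s\<^sup>2 * C\<close>, while convexity bounds the change of \<open>g j\<close> by its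
  chord. As \<open>g j\<close> may have kinks, the result is a subgradient.\<close>

lemma primal_optimality: "is_subgradient (g j) (xstar $ j) (vdual yhat $ j)"
  unfolding is_subgradient_def
proof
  fix u
  define D where "D = u - xstar $ j"
  define z where "z i = (A *v xstar) $ i" for i
  define k where "k = 1 / n * (\<Sum>i\<in>UNIV. yhat $ i * A $ i $ j)"
  define C where "C = 1 / n * (\<Sum>i\<in>UNIV. 1 / \<gamma> / 2 * (D * A $ i $ j)\<^sup>2)"
  have vd: "vdual yhat $ j = - k"
    unfolding vdual_def k_def by (simp add: matrix_vector_mult_def transpose_def mult.commute)
  have "g j u \<ge> g j (xstar $ j) - k * D - s * C" if s: "0 < s" "s < 1" for s
  proof -
    define xs where "xs = xstar + (s * D) *\<^sub>R axis j 1"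
    have "(A *v axis j 1) $ i = A $ i $ j" for i
      by (simp add: matrix_vector_mult_basis column_def)
    then have Axs: "(A *v xs) $ i = z i + s * D * A $ i $ j" for i
      unfolding xs_def z_def by (simp add: matrix_vector_right_distrib matrix_vector_mult_scaleR)
    have "primal_obj A \<phi> g xstar \<le> primal_obj A \<phi> g xs"
      using xstar by (simp add: is_arg_min_linorder)
    then have "1 / n * (\<Sum>i\<in>UNIV. \<phi> i (z i)) + g j (xstar $ j)
        \<le> 1 / n * (\<Sum>i\<in>UNIV. \<phi> i (z i + s * D * A $ i $ j)) + g j (xstar $ j + s * D)"
      unfolding primal_obj_alt Axs z_def[symmetric] by (simp add: xs_def separable_update)
    also have "1 / n * (\<Sum>i\<in>UNIV. \<phi> i (z i + s * D * A $ i $ j))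
        \<le> 1 / n * (\<Sum>i\<in>UNIV. \<phi> i (z i) + s * D * (yhat $ i * A $ i $ j)
            + s\<^sup>2 * (1 / \<gamma> / 2 * (D * A $ i $ j)\<^sup>2))"
    proof (intro mult_left_mono sum_mono)
      fix i
      have "\<phi> i (z i + s * D * A $ i $ j) \<le> \<phi> i (z i) + yhat $ i * (s * D * A $ i $ j)
          + 1 / \<gamma> / 2 * (s * D * A $ i $ j)\<^sup>2"
        using smooth_bound[OF \<phi>_smooth, of i "z i + s * D * A $ i $ j" "z i"]
        by (simp add: yhat_def z_def)
      then show "\<phi> i (z i + s * D * A $ i $ j) \<le> \<phi> i (z i) + s * D * (yhat $ i * A $ i $ j)
          + s\<^sup>2 * (1 / \<gamma> / 2 * (D * A $ i $ j)\<^sup>2)"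
        by (simp add: power_mult_distrib mult_ac)
    qed (use n_pos in simp)
    also have "\<dots> = 1 / n * (\<Sum>i\<in>UNIV. \<phi> i (z i)) + s * D * k + s\<^sup>2 * C"
      unfolding k_def C_def sum.distrib sum_distrib_left[symmetric] by (simp add: algebra_simps)
    also have "g j (xstar $ j + s * D) \<le> (1 - s) * g j (xstar $ j) + s * g j u"
    proof -
      have "xstar $ j + s * D = (1 - s) * xstar $ j + s * u"
        unfolding D_def by (simp add: algebra_simps)
      moreover have "lam / 2 * (s * (1 - s) * (u - xstar $ j)\<^sup>2) \<ge> 0"
        using s lam by (intro mult_nonneg_nonneg) auto
      ultimately show ?thesis
        using strongly_convex_combination[OF g_sc, of s j "xstar $ j" u] s by simp
    qed
    finally have "s * (g j (xstar $ j) - k * D - s * C) \<le> s * g j u"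
      by (simp add: algebra_simps power2_eq_square)
    then show ?thesis using s by simp
  qed
  then have "g j u \<ge> g j (xstar $ j) - k * D" by (rule ge_if_ge_one_minus)
  then show "g j (xstar $ j) + vdual yhat $ j * (u - xstar $ j) \<le> g j u"
    unfolding vd D_def by simp
qed

text \<open>Strong duality holds at the pair \<open>(xstar, yhat)\<close>, so Fenchel's inequality is tight at
  \<open>ystar\<close>; a tight Fenchel inequality characterizes the derivative of \<open>\<phi> i\<close>.\<close>

lemma ystar_dom_eq_yhat: "ystar \<in> dom" "ystar = yhat"
proof -
  define z where "z i = (A *v xstar) $ i" for i
  have yh: "convex_conjugate (\<phi> i) (yhat $ i) = ereal (yhat $ i * z i - \<phi> i (z i))" for i
    unfolding z_def by (rule convex_conjugate_at_subgradient[OF yhat_subgradient])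
  then have yd: "yhat \<in> dom" unfolding dom_def by simp
  have hy: "h yhat = 1 / n * (yhat \<bullet> (A *v xstar)) - 1 / n * (\<Sum>i\<in>UNIV. \<phi> i (z i))"
    unfolding h_sum conj_real_def yh
    by (simp add: sum_subtractf inner_vec_def z_def right_diff_distrib diff_divide_distrib)
  have "convex_conjugate (separable g) (vdual yhat)
    \<le> ereal (xstar \<bullet> vdual yhat - separable g xstar)"
    using convex_conjugate_separable_le[OF g_sc lam primal_optimality, of "vdual yhat"] by simp
  then have "dual_obj A \<phi> g yhat \<ge> ereal (- (xstar \<bullet> vdual yhat - separable g xstar)) - ereal (h yhat)"
    unfolding dual_obj_dom[OF yd]
    by (cases "convex_conjugate (separable g) (vdual yhat)") auto
  moreover have "\<not> dual_obj A \<phi> g ystar < dual_obj A \<phi> g yhat"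
    using ystar unfolding is_arg_max_def by simp
  ultimately have D: "dual_obj A \<phi> g ystar
      \<ge> ereal (1 / n * (\<Sum>i\<in>UNIV. \<phi> i (z i)) + separable g xstar)"
    unfolding hy vdual_inner by (simp add: not_less algebra_simps)
  \<comment> \<open>Outside \<open>dom\<close> the dual value is minus infinity, which contradicts
    the finite lower bound.\<close>
  show dom: "ystar \<in> dom"
    using D dual_obj_not_dom by fastforce
  have "convex_conjugate (separable g) (vdual ystar) \<ge> ereal (xstar \<bullet> vdual ystar - separable g xstar)"
    by (rule convex_conjugate_ge)
  then have "dual_obj A \<phi> g ystar \<le> ereal (- (xstar \<bullet> vdual ystar - separable g xstar)) - ereal (h ystar)"
    unfolding dual_obj_dom[OF dom]
    by (cases "convex_conjugate (separable g) (vdual ystar)") auto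
  from order_trans[OF D this]
  have "1 / n * (\<Sum>i\<in>UNIV. conj_real i (ystar $ i) - (ystar $ i * z i - \<phi> i (z i))) \<le> 0"
    unfolding vdual_inner h_sum
    by (simp add: sum_subtractf inner_vec_def z_def right_diff_distrib diff_divide_distrib)
  then have le: "(\<Sum>i\<in>UNIV. conj_real i (ystar $ i) - (ystar $ i * z i - \<phi> i (z i))) \<le> 0"
    using n_pos by (simp add: divide_le_0_iff)
  have nn: "conj_real i (ystar $ i) - (ystar $ i * z i - \<phi> i (z i)) \<ge> 0" for i
    using conj_real_ge[OF dom] by simp
  \<comment> \<open>Each Fenchel gap is nonnegative and their sum is at most 0, so every coordinate
    is tight.\<close>
  have "conj_real i (ystar $ i) - (ystar $ i * z i - \<phi> i (z i)) = 0" for i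
  proof -
    have "(\<Sum>i\<in>UNIV. conj_real i (ystar $ i) - (ystar $ i * z i - \<phi> i (z i))) = 0"
      using le nn by (intro antisym sum_nonneg) auto
    then show ?thesis using nn by (subst (asm) sum_nonneg_eq_0_iff) auto
  qed
  then have "is_subgradient (\<phi> i) (z i) (ystar $ i)" for i
    using conj_real_ge[OF dom, of i] unfolding is_subgradient_def by (smt (verit) right_diff_distrib)
  then have "ystar $ i = deriv (\<phi> i) (z i)" for i
    using smooth_subgradient_eq_deriv[OF \<phi>_smooth] by blast
  then show "ystar = yhat" unfolding yhat_def z_def by (simp add: vec_eq_iff)
qed

lemma conj_real_ystar: "conj_real i (ystar $ i) = ystar $ i * (A *v xstar) $ i - \<phi> i ((A *v xstar) $ i)"
  unfolding conj_real_def ystar_dom_eq_yhat(2)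
  by (simp add: convex_conjugate_at_subgradient[OF yhat_subgradient])

section \<open>Lagrangian gaps and the duality gap\<close>

definition G :: "real^'p \<Rightarrow> real" where
  "G x = separable g x - separable g xstar + 1 / n * (ystar \<bullet> (A *v (x - xstar)))"

definition H :: "real^'n \<Rightarrow> real" where
  "H y = h y - h ystar - 1 / n * ((y - ystar) \<bullet> (A *v xstar))"

lemma G_nonneg: "G x \<ge> 0"
proof -
  have "(\<Sum>j\<in>UNIV. g j (xstar $ j) + (x - xstar) $ j * vdual ystar $ j) \<le> separable g x"
    unfolding separable_def
  proof (rule sum_mono)
    fix j
    show "g j (xstar $ j) + (x - xstar) $ j * vdual ystar $ j \<le> g j (x $ j)"
      using primal_optimality[of j] unfolding ystar_dom_eq_yhat(2) is_subgradient_def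
      by (simp add: mult.commute)
  qed
  then have "separable g xstar + (x - xstar) \<bullet> vdual ystar \<le> separable g x"
    by (simp add: sum.distrib separable_def inner_vec_def)
  then show ?thesis unfolding G_def vdual_inner by simp
qed

lemma H_nonneg: "H y \<ge> 0" if "y \<in> dom"
proof -
  have "(\<Sum>i\<in>UNIV. conj_real i (ystar $ i) + (y - ystar) $ i * (A *v xstar) $ i)
      \<le> (\<Sum>i\<in>UNIV. conj_real i (y $ i))"
  proof (rule sum_mono)
    fix i
    show "conj_real i (ystar $ i) + (y - ystar) $ i * (A *v xstar) $ i \<le> conj_real i (y $ i)"
      using conj_real_ge[OF that, of i "(A *v xstar) $ i"] conj_real_ystar[of i]
      by (simp add: algebra_simps)
  qed
  then have "1 / n * ((\<Sum>i\<in>UNIV. conj_real i (ystar $ i)) + (y - ystar) \<bullet> (A *v xstar))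
      \<le> 1 / n * (\<Sum>i\<in>UNIV. conj_real i (y $ i))"
    using n_pos by (intro mult_left_mono) (simp_all add: sum.distrib inner_vec_def)
  then show ?thesis unfolding H_def h_sum by (simp add: distrib_left add_divide_distrib)
qed

lemma norm_matrix_le: "norm (A *v x) \<le> spectral_norm A * norm x"
  unfolding spectral_norm_def by (rule onorm) simp

lemma norm_transpose_le: "norm (transpose A *v y) \<le> spectral_norm A * norm y"
proof (cases "transpose A *v y = 0")
  case False
  define w where "w = transpose A *v y"
  have "(norm w)\<^sup>2 = y \<bullet> (A *v w)"
    unfolding power2_norm_eq_inner by (subst (1) w_def) (rule transpose_inner)
  also have "\<dots> \<le> norm y * (spectral_norm A * norm w)"
    by (rule order_trans[OF norm_cauchy_schwarz]) (intro mult_left_mono norm_matrix_le norm_ge_zero)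
  finally have "norm w * norm w \<le> (spectral_norm A * norm y) * norm w"
    by (simp add: power2_eq_square mult_ac)
  then show ?thesis using False unfolding w_def by simp
next
  case True
  have "spectral_norm A \<ge> 0" unfolding spectral_norm_def by (rule onorm_pos_le) simp
  with True show ?thesis by simp
qed

text \<open>The duality gap exceeds \<open>G x + H y\<close> by exactly two first-order Taylor
  remainders: that of the averaged losses at \<open>A *v xstar\<close>, and that of the conjugate of
  \<open>separable g\<close> at \<open>vdual ystar\<close>. Convexity makes them nonnegative and
  smoothness bounds them quadratically.\<close>

lemma dual_obj_real:
  assumes "y \<in> dom"
  obtains d where "dual_obj A \<phi> g y = ereal d"
    "G x + H y \<le> primal_obj A \<phi> g x - d"
    "primal_obj A \<phi> g x - d \<le> G x + H y
      + (spectral_norm A)\<^sup>2 / (2 * n * \<gamma>) * (norm (x - xstar))\<^sup>2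
      + (spectral_norm A)\<^sup>2 / (2 * lam * n\<^sup>2) * (norm (y - ystar))\<^sup>2"
proof -
  define K where "K = (spectral_norm A)\<^sup>2"
  define hs where "hs = h ystar"
  have up: "convex_conjugate (separable g) (vdual y) \<le> ereal (xstar \<bullet> vdual y - separable g xstar
      + (norm (vdual y - vdual ystar))\<^sup>2 / (2 * lam))"
    using convex_conjugate_separable_le[OF g_sc lam primal_optimality, of "vdual y"]
    unfolding ystar_dom_eq_yhat(2) .
  have lo: "ereal (xstar \<bullet> vdual y - separable g xstar) \<le> convex_conjugate (separable g) (vdual y)"
    by (rule convex_conjugate_ge)
  obtain c where c: "convex_conjugate (separable g) (vdual y) = ereal c"
    using up lo by (cases "convex_conjugate (separable g) (vdual y)") auto
  have d: "dual_obj A \<phi> g y = ereal (- c - h y)"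
    unfolding dual_obj_dom[OF assms] c by simp
  have vd: "(norm (vdual y - vdual ystar))\<^sup>2 / (2 * lam) \<le> K / (2 * lam * n\<^sup>2) * (norm (y - ystar))\<^sup>2"
  proof -
    have "norm (vdual (y - ystar)) = 1 / n * norm (transpose A *v (y - ystar))"
      unfolding vdual_def using n_pos by simp
    also have "\<dots> \<le> 1 / n * (spectral_norm A * norm (y - ystar))"
      using n_pos by (intro mult_left_mono norm_transpose_le) simp
    finally have "(norm (vdual (y - ystar)))\<^sup>2 \<le> (1 / n * (spectral_norm A * norm (y - ystar)))\<^sup>2"
      by (intro power_mono) auto
    then have "(norm (vdual (y - ystar)))\<^sup>2 / (2 * lam)
        \<le> (1 / n * (spectral_norm A * norm (y - ystar)))\<^sup>2 / (2 * lam)"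
      using lam by (intro divide_right_mono) auto
    also have "\<dots> = K / (2 * lam * n\<^sup>2) * (norm (y - ystar))\<^sup>2"
      unfolding K_def by (simp add: power_mult_distrib power_divide mult.commute)
    finally show ?thesis unfolding vdual_diff .
  qed
  have hs: "hs = 1 / n * (ystar \<bullet> (A *v xstar)) - 1 / n * (\<Sum>i\<in>UNIV. \<phi> i ((A *v xstar) $ i))"
    unfolding hs_def h_sum conj_real_ystar
    by (simp add: sum_subtractf inner_vec_def right_diff_distrib diff_divide_distrib)
  have P_lo: "primal_obj A \<phi> g x \<ge> 1 / n * (ystar \<bullet> (A *v x)) - hs + separable g x"
  proof -
    have "(\<Sum>i\<in>UNIV. ystar $ i * (A *v x) $ i - conj_real i (ystar $ i))
        \<le> (\<Sum>i\<in>UNIV. \<phi> i ((A *v x) $ i))"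
    proof (rule sum_mono)
      fix i
      show "ystar $ i * (A *v x) $ i - conj_real i (ystar $ i) \<le> \<phi> i ((A *v x) $ i)"
        using conj_real_ge[OF ystar_dom_eq_yhat(1), of i "(A *v x) $ i"] by simp
    qed
    then have "1 / n * (ystar \<bullet> (A *v x) - (\<Sum>i\<in>UNIV. conj_real i (ystar $ i)))
        \<le> 1 / n * (\<Sum>i\<in>UNIV. \<phi> i ((A *v x) $ i))"
      using n_pos by (intro mult_left_mono) (simp_all add: inner_vec_def sum_subtractf)
    then show ?thesis
      unfolding primal_obj_alt hs_def h_sum right_diff_distrib by simp
  qed
  have P_up: "primal_obj A \<phi> g x \<le> separable g x + 1 / n * (\<Sum>i\<in>UNIV. \<phi> i ((A *v xstar) $ i))
      + 1 / n * (ystar \<bullet> (A *v (x - xstar))) + K / (2 * n * \<gamma>) * (norm (x - xstar))\<^sup>2"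
  proof -
    have "(\<Sum>i\<in>UNIV. \<phi> i ((A *v x) $ i)) \<le> (\<Sum>i\<in>UNIV. \<phi> i ((A *v xstar) $ i)
        + ystar $ i * (A *v (x - xstar)) $ i + 1 / \<gamma> / 2 * ((A *v (x - xstar)) $ i)\<^sup>2)"
    proof (rule sum_mono)
      fix i
      show "\<phi> i ((A *v x) $ i) \<le> \<phi> i ((A *v xstar) $ i)
        + ystar $ i * (A *v (x - xstar)) $ i + 1 / \<gamma> / 2 * ((A *v (x - xstar)) $ i)\<^sup>2"
        using smooth_bound[OF \<phi>_smooth, of i "(A *v x) $ i" "(A *v xstar) $ i"]
        unfolding ystar_dom_eq_yhat(2) yhat_def by (simp add: matrix_vector_mult_diff_distrib)
    qed
    also have "\<dots> = (\<Sum>i\<in>UNIV. \<phi> i ((A *v xstar) $ i)) + ystar \<bullet> (A *v (x - xstar))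
        + 1 / \<gamma> / 2 * (norm (A *v (x - xstar)))\<^sup>2"
      unfolding norm_power2_vec inner_vec_def sum_distrib_left by (simp add: sum.distrib)
    also have "\<dots> \<le> (\<Sum>i\<in>UNIV. \<phi> i ((A *v xstar) $ i)) + ystar \<bullet> (A *v (x - xstar))
        + 1 / \<gamma> / 2 * (spectral_norm A * norm (x - xstar))\<^sup>2"
      using gam by (intro add_left_mono mult_left_mono power_mono norm_matrix_le) auto
    finally have "1 / n * (\<Sum>i\<in>UNIV. \<phi> i ((A *v x) $ i)) \<le> 1 / n * ((\<Sum>i\<in>UNIV. \<phi> i ((A *v xstar) $ i))
        + ystar \<bullet> (A *v (x - xstar)) + 1 / \<gamma> / 2 * (spectral_norm A * norm (x - xstar))\<^sup>2)"
      using n_pos by (intro mult_left_mono) auto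
    also have "\<dots> = 1 / n * (\<Sum>i\<in>UNIV. \<phi> i ((A *v xstar) $ i)) + 1 / n * (ystar \<bullet> (A *v (x - xstar)))
      + K / (2 * n * \<gamma>) * (norm (x - xstar))\<^sup>2"
      unfolding K_def by (simp add: distrib_left power_mult_distrib add_divide_distrib mult_ac)
    finally show ?thesis unfolding primal_obj_alt by simp
  qed
  have c_le: "c \<le> xstar \<bullet> vdual y - separable g xstar + K / (2 * lam * n\<^sup>2) * (norm (y - ystar))\<^sup>2"
    using up vd unfolding c by simp
  have c_ge: "c \<ge> xstar \<bullet> vdual y - separable g xstar"
    using lo unfolding c by simp
  show ?thesis
  proof (rule that[OF d])
    show "G x + H y \<le> primal_obj A \<phi> g x - (- c - h y)"
      using P_lo c_ge
      by (simp add: G_def H_def hs_def vdual_inner matrix_vector_mult_diff_distrib inner_diff_left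
          inner_diff_right diff_divide_distrib)
    show "primal_obj A \<phi> g x - (- c - h y) \<le> G x + H y
      + (spectral_norm A)\<^sup>2 / (2 * n * \<gamma>) * (norm (x - xstar))\<^sup>2
      + (spectral_norm A)\<^sup>2 / (2 * lam * n\<^sup>2) * (norm (y - ystar))\<^sup>2"
      using P_up c_le hs unfolding K_def[symmetric]
      by (simp add: G_def H_def hs_def vdual_inner matrix_vector_mult_diff_distrib inner_diff_left
          inner_diff_right diff_divide_distrib)
  qed
qed

end

subsection \<open>The iteration\<close>

lemma expectation_bind_finite:
  fixes f :: "'b \<Rightarrow> real"
  assumes "finite (set_pmf M)" "\<And>x. x \<in> set_pmf M \<Longrightarrow> finite (set_pmf (K x))"
  shows "measure_pmf.expectation (bind_pmf M K) f
    = measure_pmf.expectation M (\<lambda>x. measure_pmf.expectation (K x) f)"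
  using assms by (subst pmf_expectation_bind[of "set_pmf M"]) (auto simp: integral_measure_pmf[of "set_pmf M"])

lemma expectation_mono_finite:
  fixes f g :: "'b \<Rightarrow> real"
  assumes "finite (set_pmf M)" "\<And>x. x \<in> set_pmf M \<Longrightarrow> f x \<le> g x"
  shows "measure_pmf.expectation M f \<le> measure_pmf.expectation M g"
  using assms by (intro integral_mono_AE integrable_measure_pmf_finite) (auto simp: AE_measure_pmf_iff)

lemma am_gm_weighted:
  fixes \<alpha> \<beta> k d e :: real
  assumes "\<alpha> > 0" "k\<^sup>2 \<le> 4 * \<alpha> * \<beta>"
  shows "k * d * e \<le> \<alpha> * d\<^sup>2 + \<beta> * e\<^sup>2"
proof -
  have "4 * \<alpha> * (\<alpha> * d\<^sup>2 + \<beta> * e\<^sup>2 - k * d * e) = (2 * \<alpha> * d - k * e)\<^sup>2 + (4 * \<alpha> * \<beta> - k\<^sup>2) * e\<^sup>2"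
    by (simp add: algebra_simps power2_eq_square)
  also have "\<dots> \<ge> 0" using assms by simp
  finally show ?thesis using assms(1) by (simp add: zero_le_mult_iff)
qed

text \<open>The smaller of \<open>X\<close> and \<open>Y\<close> is at most \<open>S\<close>, and by
  \<open>eq\<close> it is accompanied by the larger of \<open>u\<close> and
  \<open>v\<close>.\<close>

lemma sum_le_add_max_of_prod:
  fixes X Y S u v :: real
  assumes "X \<ge> 0" "S \<ge> 0" and prod: "X * Y = S\<^sup>2" and eq: "X + u = Y + v"
  shows "X + u \<le> S + max u v"
proof (cases "u \<ge> v")
  case True
  then have "X * X \<le> X * Y" using assms by (intro mult_left_mono) auto
  then have "X\<^sup>2 \<le> S\<^sup>2" using prod unfolding power2_eq_square[of X] by linarith
  then have "X \<le> S" using \<open>S \<ge> 0\<close> by (rule power2_le_imp_le)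
  with True show ?thesis by simp
next
  case False
  then have "Y \<le> X" using eq by simp
  have "Y \<le> S"
  proof (cases "Y \<ge> 0")
    case True
    then have "Y * Y \<le> X * Y" using \<open>Y \<le> X\<close> by (intro mult_right_mono) auto
    then have "Y\<^sup>2 \<le> S\<^sup>2" using prod unfolding power2_eq_square[of Y] by linarith
    then show ?thesis using \<open>S \<ge> 0\<close> by (rule power2_le_imp_le)
  qed (use assms in simp)
  with False eq show ?thesis by simp
qed

text \<open>Each proximal coordinate depends on the old state only, so the random block merely
  selects coordinates of the deterministic full update. This is the form that
  \<open>random_prox_gap\<close> expects.\<close>

lemma dual_update_block:
  "dual_update A \<phi> \<sigma> I xbar y = (\<chi> i. if i \<in> I then dual_update A \<phi> \<sigma> UNIV xbar y $ i else y $ i)"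
  unfolding dual_update_def by (simp add: vec_eq_iff)

lemma primal_update_block:
  "primal_update A g \<tau> J ybar x = (\<chi> j. if j \<in> J then primal_update A g \<tau> UNIV ybar x $ j else x $ j)"
  unfolding primal_update_def by (simp add: vec_eq_iff)

lemma spectral_norm_submatrix_le:
  fixes A :: "real^'p^'n"
  assumes "card I = m" "card J = q"
  shows "(spectral_norm (submatrix A I J))\<^sup>2 \<le> Lambda_max A q m"
  unfolding Lambda_max_def
proof (rule Max_ge)
  have "{(spectral_norm (submatrix A I J))\<^sup>2 | I J. card I = m \<and> card J = q}
    \<subseteq> (\<lambda>(I, J). (spectral_norm (submatrix A I J))\<^sup>2) ` UNIV" by auto
  then show "finite {(spectral_norm (submatrix A I J))\<^sup>2 | I J. card I = m \<and> card J = q}"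
    by (rule finite_subset) simp
qed (use assms in blast)

lemma submatrix_vector_mult:
  fixes A :: "real^'p^'n"
  assumes "\<And>j. j \<notin> J \<Longrightarrow> d $ j = 0"
  shows "(submatrix A I J *v d) $ i = (if i \<in> I then (A *v d) $ i else 0)"
  unfolding submatrix_def matrix_vector_mult_def
  using assms by (auto intro!: sum.cong)

section \<open>Parameters and contraction rates\<close>

locale dspdc_problem = saddle_problem A \<phi> g n lam \<gamma> xstar ystar
  for A :: "real^'p^'n" and \<phi> g n lam \<gamma> xstar ystar +
  fixes p :: real and m q :: nat and \<Lambda> \<tau> \<sigma> \<theta> :: real
  assumes p: "p = real CARD('p)"
    and m: "m \<in> {1..CARD('n)}" and q: "q \<in> {1..CARD('p)}"
    and \<Lambda>: "\<Lambda> > 0" "\<Lambda> \<ge> Lambda_max A q m"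
    and \<tau>: "\<tau> > 0" and \<sigma>: "\<sigma> > 0"
    and step_prod: "\<tau> * \<sigma> = n * real m * real q / (4 * p * \<Lambda>)"
    and step_balance: "p / (2 * real q * lam * \<tau>) + p / real q
         = n\<^sup>2 / (2 * real m * \<gamma> * \<sigma>) + n / real m"
    and \<theta>_def: "\<theta> = p / real q - (p / real q)
           / (2 * sqrt (\<Lambda> / (lam * \<gamma> * n)) * ((n * p) / (real m * real q))
              + 2 * max (n / real m) (p / real q))"
begin

definition "rp = p / real q"
definition "rd = n / real m"
definition "R = 2 * sqrt (\<Lambda> / (lam * \<gamma> * n)) * ((n * p) / (real m * real q)) + 2 * max rd rp"
definition "rho = 1 - 1 / R"
definition "a = rp / (2 * \<tau>) + rp * lam / 2"
text \<open>The modulus \<open>\<gamma> / n\<close> is that of a conjugate divided by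
  \<open>n\<close>, as it appears in the dual proximal problem; \<open>a\<close> and
  \<open>b\<close> are the weights produced by \<open>random_prox_gap\<close>.\<close>

definition "b = rd / (2 * \<sigma>) + rd * (\<gamma> / n) / 2"

lemma p_pos: "p > 0" and m_pos: "real m > 0" and q_pos: "real q > 0"
  using m q by (auto simp: p)

lemma rp_ge: "rp \<ge> 1" and rd_ge: "rd \<ge> 1"
  unfolding rp_def rd_def using m q by (simp_all add: p n)

lemma rd_over_n: "rd / n = 1 / real m"
  unfolding rd_def using n_pos by simp

lemma R_ge: "R \<ge> 2 * max rd rp"
proof -
  have "sqrt (\<Lambda> / (lam * \<gamma> * n)) * ((n * p) / (real m * real q)) \<ge> 0"
    using \<Lambda> lam gam n_pos p_pos by (intro mult_nonneg_nonneg) auto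
  then show ?thesis unfolding R_def by simp
qed

lemma R_ge_2: "R \<ge> 2"
  using R_ge rp_ge by simp

lemma rho: "0 < rho" "rho < 1"
  using R_ge_2 unfolding rho_def by simp_all

lemma theta: "\<theta> = rho * rp"
  unfolding \<theta>_def rho_def R_def rp_def rd_def by (simp add: algebra_simps)

lemma theta_pos: "\<theta> > 0"
  unfolding theta using rho rp_ge by simp

lemma step_prod': "4 * rp * rd * \<Lambda> * (\<tau> * \<sigma>) = n\<^sup>2"
  unfolding step_prod rp_def rd_def
  using p_pos m_pos q_pos \<Lambda> by (simp add: field_simps power2_eq_square)

text \<open>The balance rule says that the two left sides are equal, and the step product fixes the
  product of their first summands, so \<open>sum_le_add_max_of_prod\<close> applies.\<close>

lemma balance_le: "rp / (2 * lam * \<tau>) + rp \<le> R / 2" "rd * n / (2 * \<gamma> * \<sigma>) + rd \<le> R / 2"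
proof -
  define X where "X = rp / (2 * lam * \<tau>)"
  define Y where "Y = rd * n / (2 * \<gamma> * \<sigma>)"
  define S where "S = sqrt (\<Lambda> / (lam * \<gamma> * n)) * ((n * p) / (real m * real q))"
  have eq: "X + rp = Y + rd"
    using step_balance unfolding X_def Y_def rp_def rd_def by (simp add: power2_eq_square mult_ac)
  \<comment> \<open>Common factor that clears the step sizes and moduli from both
    \<open>X * Y\<close> and \<open>S\<^sup>2\<close>.\<close>
  define c where "c = 4 * lam * \<gamma> * (\<tau> * \<sigma>)"
  have c: "c > 0" unfolding c_def using lam gam \<tau> \<sigma> by simp
  have "(n * p) / (real m * real q) = rp * rd" unfolding rp_def rd_def by (simp add: mult.commute)
  then have "S\<^sup>2 = (sqrt (\<Lambda> / (lam * \<gamma> * n)))\<^sup>2 * (rp * rd)\<^sup>2"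
    unfolding S_def by (simp only: power_mult_distrib)
  also have "(sqrt (\<Lambda> / (lam * \<gamma> * n)))\<^sup>2 = \<Lambda> / (lam * \<gamma> * n)"
    using \<Lambda> lam gam n_pos by (intro real_sqrt_pow2) auto
  also have "\<Lambda> / (lam * \<gamma> * n) * (rp * rd)\<^sup>2 * c = rp * rd / n * (4 * rp * rd * \<Lambda> * (\<tau> * \<sigma>))"
    unfolding c_def using lam gam by (simp add: power2_eq_square)
  finally have "S\<^sup>2 * c = rp * rd * n"
    unfolding step_prod' using n_pos by (simp add: power2_eq_square)
  moreover have "X * Y * c = rp * rd * n"
    unfolding X_def Y_def c_def using lam gam \<tau> \<sigma> by simp
  ultimately have "X * Y = S\<^sup>2" using c by (metis mult_right_cancel less_irrefl)
  then have "X + rp \<le> S + max rp rd"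
    using eq lam \<tau> rp_ge \<Lambda> gam n_pos p_pos
    by (intro sum_le_add_max_of_prod[where Y = Y]) (auto simp: X_def S_def)
  then have "X + rp \<le> R / 2" unfolding R_def S_def by (simp add: max.commute)
  with eq show "rp / (2 * lam * \<tau>) + rp \<le> R / 2" "rd * n / (2 * \<gamma> * \<sigma>) + rd \<le> R / 2"
    unfolding X_def Y_def by simp_all
qed

text \<open>As \<open>rho = 1 - 1 / R\<close>, the claim is \<open>a / R \<le> lam / 2\<close>, and
  \<open>a / lam\<close> lies below the left side of \<open>balance_le\<close> by
  \<open>rp / 2\<close>.\<close>

lemma contraction_primal: "a - lam / 2 \<le> rho * a"
proof -
  have "a = lam * (rp / (2 * lam * \<tau>) + rp / 2)"
    unfolding a_def using lam by (simp add: field_simps)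
  also have "\<dots> \<le> lam * (R / 2)"
    using balance_le(1) rp_ge lam by (intro mult_left_mono) auto
  finally have "a / R \<le> lam / 2" using R_ge_2 by (simp add: field_simps)
  then show ?thesis unfolding rho_def by (simp add: algebra_simps)
qed

lemma contraction_dual: "b - \<gamma> / n / 2 \<le> rho * b"
proof -
  have "b = \<gamma> / n * (rd * n / (2 * \<gamma> * \<sigma>) + rd / 2)"
    unfolding b_def using gam n_pos by (simp add: field_simps)
  also have "\<dots> \<le> \<gamma> / n * (R / 2)"
    using balance_le(2) rd_ge gam n_pos by (intro mult_left_mono) auto
  finally have "b / R \<le> \<gamma> / n / 2" using R_ge_2 by (simp add: field_simps)
  then show ?thesis unfolding rho_def by (simp add: algebra_simps)
qed

lemma contraction_gap: "rp - 1 \<le> rho * rp" "rd - 1 \<le> rho * rd"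
proof -
  have "rp / R \<le> 1" "rd / R \<le> 1" using R_ge R_ge_2 rp_ge rd_ge by (auto simp: field_simps)
  then show "rp - 1 \<le> rho * rp" "rd - 1 \<le> rho * rd"
    unfolding rho_def by (simp_all add: algebra_simps)
qed

section \<open>Bounds for the bilinear form on blocks\<close>

lemma block_norm_le:
  assumes "card I = m" "card J = q" and d: "\<And>j. j \<notin> J \<Longrightarrow> d $ j = 0"
  shows "(norm (submatrix A I J *v d))\<^sup>2 \<le> \<Lambda> * (norm d)\<^sup>2"
proof -
  have "norm (submatrix A I J *v d) \<le> spectral_norm (submatrix A I J) * norm d"
    unfolding spectral_norm_def by (rule onorm) simp
  then have "(norm (submatrix A I J *v d))\<^sup>2 \<le> (spectral_norm (submatrix A I J) * norm d)\<^sup>2"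
    by (rule power_mono) simp
  also have "\<dots> \<le> \<Lambda> * (norm d)\<^sup>2"
    unfolding power_mult_distrib
    using spectral_norm_submatrix_le[OF assms(1,2), of A] \<Lambda> by (intro mult_right_mono) auto
  finally show ?thesis .
qed

lemma block_inner_le:
  assumes I: "card I = m" and J: "card J = q"
    and d: "\<And>j. j \<notin> J \<Longrightarrow> d $ j = 0" and e: "\<And>i. i \<notin> I \<Longrightarrow> e $ i = 0"
  shows "\<bar>e \<bullet> (A *v d)\<bar> \<le> sqrt \<Lambda> * norm d * norm e"
proof -
  have "e \<bullet> (A *v d) = e \<bullet> (submatrix A I J *v d)"
    unfolding inner_vec_def using e by (intro sum.cong) (auto simp: submatrix_vector_mult[OF d])
  moreover have "norm (submatrix A I J *v d) \<le> sqrt \<Lambda> * norm d"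
    using real_sqrt_le_mono[OF block_norm_le[OF I J d]] by (simp add: real_sqrt_mult)
  ultimately show ?thesis
    using Cauchy_Schwarz_ineq2[of e "submatrix A I J *v d"]
    by (smt (verit, best) mult.commute mult_left_mono norm_ge_zero)
qed

text \<open>A random row block carries the fraction \<open>m / n\<close> of the squared norm on average.\<close>

lemma column_block_norm_le:
  assumes J: "card J = q" and d: "\<And>j. j \<notin> J \<Longrightarrow> d $ j = 0"
  shows "(norm (A *v d))\<^sup>2 \<le> rd * \<Lambda> * (norm d)\<^sup>2"
proof -
  let ?S = "{I :: 'n set. card I = m}"
  have mn: "m \<le> CARD('n)" using m by simp
  have "real m / n * (norm (A *v d))\<^sup>2
    = measure_pmf.expectation (pmf_of_set ?S) (\<lambda>I. \<Sum>i\<in>UNIV. if i \<in> I then ((A *v d) $ i)\<^sup>2 else 0)"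
    unfolding expectation_random_subset[OF mn] norm_power2_vec
    by (simp add: n sum_distrib_left)
  also have "\<dots> \<le> measure_pmf.expectation (pmf_of_set ?S) (\<lambda>I. \<Lambda> * (norm d)\<^sup>2)"
  proof (rule expectation_mono_finite)
    fix I assume "I \<in> set_pmf (pmf_of_set ?S)"
    then have I: "card I = m" unfolding set_pmf_subsets_of_size[OF mn] by simp
    have "(\<Sum>i\<in>UNIV. if i \<in> I then ((A *v d) $ i)\<^sup>2 else 0) = (norm (submatrix A I J *v d))\<^sup>2"
      unfolding norm_power2_vec by (intro sum.cong) (auto simp: submatrix_vector_mult[OF d])
    also have "\<dots> \<le> \<Lambda> * (norm d)\<^sup>2" by (rule block_norm_le[OF I J d])
    finally show "(\<Sum>i\<in>UNIV. if i \<in> I then ((A *v d) $ i)\<^sup>2 else 0) \<le> \<Lambda> * (norm d)\<^sup>2" .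
  qed simp
  finally show ?thesis
    unfolding rd_def using m_pos n_pos by (simp add: field_simps)
qed

section \<open>The potential and its one-step change\<close>

definition W :: "real^'p \<Rightarrow> real^'p \<Rightarrow> real^'n \<Rightarrow> real" where
  "W x d y = a * (norm (x - xstar))\<^sup>2 + b * (norm (y - ystar))\<^sup>2 + rp * G x + rd * H y
     + rp / (4 * \<tau>) * (norm d)\<^sup>2 + rp / n * ((y - ystar) \<bullet> (A *v d))"

text \<open>The cross term is absorbed by the stored increment term and by the part
  \<open>rd / (2 * \<sigma>)\<close> of \<open>b\<close>; what survives are the strong convexity
  parts of \<open>a\<close> and \<open>b\<close>.\<close>

lemma W_ge:
  assumes "card J = q" "\<And>j. j \<notin> J \<Longrightarrow> d $ j = 0"
  shows "W x d y \<ge> rp * lam / 2 * (norm (x - xstar))\<^sup>2 + \<gamma> / (2 * real m) * (norm (y - ystar))\<^sup>2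
    + rp * G x + rd * H y"
proof -
  define k where "k = rp / n * (sqrt rd * sqrt \<Lambda>)"
  have pos: "rp > 0" "rd > 0" using rp_ge rd_ge by auto
  have k2: "k\<^sup>2 \<le> 4 * (rp / (4 * \<tau>)) * (rd / (2 * \<sigma>))"
  proof -
    have "k\<^sup>2 = rp\<^sup>2 * rd * \<Lambda> / n\<^sup>2"
      unfolding k_def using pos \<Lambda> by (simp add: power_mult_distrib power_divide)
    also have "\<dots> = rp / (4 * (\<tau> * \<sigma>))"
      unfolding step_prod'[symmetric] using pos \<Lambda> \<tau> \<sigma> by (simp add: field_simps power2_eq_square)
    also have "\<dots> \<le> rp * rd / (2 * (\<tau> * \<sigma>))"
    proof -
      have "rp \<le> 2 * (rp * rd)" using pos rd_ge
        by (metis mult_2 mult_le_cancel_left1 add_increasing2 less_imp_le mult_pos_pos not_less)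
      then show ?thesis using \<tau> \<sigma> by (simp add: field_simps)
    qed
    finally show ?thesis by simp
  qed
  have "norm (A *v d) \<le> sqrt rd * sqrt \<Lambda> * norm d"
    using real_sqrt_le_mono[OF column_block_norm_le[OF assms]] by (simp add: real_sqrt_mult)
  then have "norm (y - ystar) * norm (A *v d) \<le> norm (y - ystar) * (sqrt rd * sqrt \<Lambda> * norm d)"
    by (intro mult_left_mono) auto
  then have "\<bar>(y - ystar) \<bullet> (A *v d)\<bar> \<le> sqrt rd * sqrt \<Lambda> * norm d * norm (y - ystar)"
    using Cauchy_Schwarz_ineq2[of "y - ystar" "A *v d"] by (simp add: mult_ac)
  then have "rp / n * \<bar>(y - ystar) \<bullet> (A *v d)\<bar> \<le> rp / n * (sqrt rd * sqrt \<Lambda> * norm d * norm (y - ystar))"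
    using pos n_pos by (intro mult_left_mono) auto
  also have "\<dots> = k * norm d * norm (y - ystar)" unfolding k_def by simp
  also have "\<dots> \<le> rp / (4 * \<tau>) * (norm d)\<^sup>2 + rd / (2 * \<sigma>) * (norm (y - ystar))\<^sup>2"
    using k2 pos \<tau> by (intro am_gm_weighted) auto
  finally have 1: "rp / n * \<bar>(y - ystar) \<bullet> (A *v d)\<bar>
    \<le> rp / (4 * \<tau>) * (norm d)\<^sup>2 + rd / (2 * \<sigma>) * (norm (y - ystar))\<^sup>2" .
  have "- \<bar>(y - ystar) \<bullet> (A *v d)\<bar> \<le> (y - ystar) \<bullet> (A *v d)" by simp
  then have 2: "rp / n * (- \<bar>(y - ystar) \<bullet> (A *v d)\<bar>) \<le> rp / n * ((y - ystar) \<bullet> (A *v d))"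
    using pos n_pos by (intro mult_left_mono) auto
  have a: "a * (norm (x - xstar))\<^sup>2 \<ge> rp * lam / 2 * (norm (x - xstar))\<^sup>2"
    unfolding a_def using pos \<tau> by (intro mult_right_mono) auto
  have b: "b * (norm (y - ystar))\<^sup>2 = rd / (2 * \<sigma>) * (norm (y - ystar))\<^sup>2
      + \<gamma> / (2 * real m) * (norm (y - ystar))\<^sup>2"
    unfolding b_def rd_def using n_pos by (simp add: field_simps)
  show ?thesis unfolding W_def using 1 2 a b by linarith
qed

text \<open>The integrand of \<open>random_prox_gap\<close> for the dual block, with the coupling to
  \<open>xbar\<close> as linear term. Its sign is known only on average, so it is carried through
  the pointwise estimates and averaged at the end.\<close>

definition dual_gain :: "real^'p \<Rightarrow> real^'n \<Rightarrow> real^'n \<Rightarrow> real" where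
  "dual_gain xbar y y' = (- (1 / n) *\<^sub>R (A *v xbar)) \<bullet> (ystar - (y + rd *\<^sub>R (y' - y)))
     + h ystar - rd * h y' + (rd - 1) * h y - rd / (2 * \<sigma>) * (norm (y' - y))\<^sup>2
     - b * (norm (y' - ystar))\<^sup>2 + (b - \<gamma> / n / 2) * (norm (y - ystar))\<^sup>2"

definition primal_gain :: "real^'n \<Rightarrow> real^'p \<Rightarrow> real^'p \<Rightarrow> real" where
  "primal_gain ybar x x' = ((1 / n) *\<^sub>R (transpose A *v ybar)) \<bullet> (xstar - (x + rp *\<^sub>R (x' - x)))
     + separable g xstar - rp * separable g x' + (rp - 1) * separable g x
     - rp / (2 * \<tau>) * (norm (x' - x))\<^sup>2
     - a * (norm (x' - xstar))\<^sup>2 + (a - lam / 2) * (norm (x - xstar))\<^sup>2"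

text \<open>Function values and distances at the new point cancel between \<open>W\<close> and the
  gains. Among the bilinear terms, the products of \<open>d'\<close> with \<open>y\<close> and
  \<open>ystar\<close> and those of \<open>e\<close> with \<open>x\<close> and \<open>xstar\<close>
  cancel as well.\<close>

lemma W_step_identity:
  "W (x + d') d' (y + e) + dual_gain (x + \<theta> *\<^sub>R d) y (y + e) + primal_gain (y + rd *\<^sub>R e) x (x + d')
   = (a - lam / 2) * (norm (x - xstar))\<^sup>2 + (b - \<gamma> / n / 2) * (norm (y - ystar))\<^sup>2
     + (rp - 1) * G x + (rd - 1) * H y
     + \<theta> / n * ((y - ystar) \<bullet> (A *v d))
     + (\<theta> * rd / n * (e \<bullet> (A *v d)) - rp * (rd - 1) / n * (e \<bullet> (A *v d')))
     - rp / (4 * \<tau>) * (norm d')\<^sup>2 - rd / (2 * \<sigma>) * (norm e)\<^sup>2"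
proof -
  \<comment> \<open>Abstracting the bilinear form reduces the claim to a polynomial
    identity.\<close>
  define B where "B u v = u \<bullet> (A *v v)" for u :: "real^'n" and v :: "real^'p"
  have B_lin: "B (u + u') v = B u v + B u' v" "B (u - u') v = B u v - B u' v"
    "B (c *\<^sub>R u) v = c * B u v" "B u (v + v') = B u v + B u v'" "B u (v - v') = B u v - B u v'"
    "B u (c *\<^sub>R v) = c * B u v" for u u' v v' c
    unfolding B_def by (simp_all add: inner_add_left inner_add_right inner_diff_left inner_diff_right
        matrix_vector_right_distrib matrix_vector_mult_diff_distrib matrix_vector_mult_scaleR)
  have D: "dual_gain (x + \<theta> *\<^sub>R d) y (y + e) = - (1 / n) * B (ystar - (y + rd *\<^sub>R e)) (x + \<theta> *\<^sub>R d)
     + h ystar - rd * h (y + e) + (rd - 1) * h y - rd / (2 * \<sigma>) * (norm e)\<^sup>2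
     - b * (norm (y + e - ystar))\<^sup>2 + (b - \<gamma> / n / 2) * (norm (y - ystar))\<^sup>2"
    unfolding dual_gain_def B_def by (simp add: inner_commute)
  have P: "primal_gain (y + rd *\<^sub>R e) x (x + d') = 1 / n * B (y + rd *\<^sub>R e) (xstar - (x + rp *\<^sub>R d'))
     + separable g xstar - rp * separable g (x + d') + (rp - 1) * separable g x
     - rp / (2 * \<tau>) * (norm d')\<^sup>2
     - a * (norm (x + d' - xstar))\<^sup>2 + (a - lam / 2) * (norm (x - xstar))\<^sup>2"
    unfolding primal_gain_def B_def by (simp add: dot_lmul_matrix)
  have half: "rp / (2 * \<tau>) = 2 * (rp / (4 * \<tau>))" by simp
  show ?thesis
    unfolding D P W_def G_def H_def B_def[symmetric] half B_lin
    by (simp add: algebra_simps add_divide_distrib diff_divide_distrib)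
qed

text \<open>\<open>d\<close> is the previous primal increment and \<open>d'\<close> the new one, on
  possibly different blocks. Both are paired with the same dual increment \<open>e\<close>, and
  \<open>\<Lambda>\<close> bounds every pair of blocks.\<close>

lemma W_step:
  assumes I: "card I = m" and J: "card J = q" and J': "card J' = q"
    and d: "\<And>j. j \<notin> J \<Longrightarrow> d $ j = 0" and d': "\<And>j. j \<notin> J' \<Longrightarrow> d' $ j = 0"
    and e: "\<And>i. i \<notin> I \<Longrightarrow> e $ i = 0" and y: "y \<in> dom"
  shows "W (x + d') d' (y + e) + dual_gain (x + \<theta> *\<^sub>R d) y (y + e) + primal_gain (y + rd *\<^sub>R e) x (x + d')
   \<le> rho * W x d y"
proof -
  define k where "k = rp * rd / n * sqrt \<Lambda>"
  have pos: "rp > 0" "rd > 0" using rp_ge rd_ge by auto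
  have k2: "k\<^sup>2 \<le> 4 * (rp / (4 * \<tau>)) * (rd / (4 * \<sigma>))"
  proof -
    have "k\<^sup>2 = (rp * rd)\<^sup>2 * \<Lambda> / n\<^sup>2"
      unfolding k_def using pos \<Lambda> by (simp add: power_mult_distrib power_divide)
    also have "\<dots> = rp * rd / (4 * (\<tau> * \<sigma>))"
      unfolding step_prod'[symmetric] using pos \<Lambda> \<tau> \<sigma> by (simp add: field_simps power2_eq_square)
    finally show ?thesis by simp
  qed
  have amgm: "k * norm u * norm e \<le> rp / (4 * \<tau>) * (norm u)\<^sup>2 + rd / (4 * \<sigma>) * (norm e)\<^sup>2" for u :: "real^'p"
    using k2 pos \<tau> by (intro am_gm_weighted) auto
  \<comment> \<open>The factor \<open>rho\<close> inside \<open>\<theta>\<close> is split off before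
    AM-GM, so the cost in \<open>d\<close> is exactly \<open>rho\<close> times the stored increment
    term.\<close>
  have 1: "\<theta> * rd / n * (e \<bullet> (A *v d)) \<le> rho * (rp / (4 * \<tau>) * (norm d)\<^sup>2) + rd / (4 * \<sigma>) * (norm e)\<^sup>2"
  proof -
    have "\<theta> * rd / n * (e \<bullet> (A *v d)) \<le> \<theta> * rd / n * (sqrt \<Lambda> * norm d * norm e)"
      using block_inner_le[OF I J d e] theta_pos pos n_pos by (intro mult_left_mono) auto
    also have "\<dots> = rho * (k * norm d * norm e)" unfolding theta k_def by simp
    also have "\<dots> \<le> rho * (rp / (4 * \<tau>) * (norm d)\<^sup>2 + rd / (4 * \<sigma>) * (norm e)\<^sup>2)"
      using amgm rho by (intro mult_left_mono) auto
    also have "\<dots> \<le> rho * (rp / (4 * \<tau>) * (norm d)\<^sup>2) + rd / (4 * \<sigma>) * (norm e)\<^sup>2"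
    proof -
      have "rd / (4 * \<sigma>) * (norm e)\<^sup>2 \<ge> 0" using pos \<sigma> by simp
      then have "rho * (rd / (4 * \<sigma>) * (norm e)\<^sup>2) \<le> rd / (4 * \<sigma>) * (norm e)\<^sup>2"
        using rho by (intro mult_left_le_one_le) auto
      then show ?thesis unfolding distrib_left by linarith
    qed
    finally show ?thesis .
  qed
  \<comment> \<open>Enlarging \<open>rd - 1\<close> to \<open>rd\<close> allows the same constant
    \<open>k\<close> to be used.\<close>
  have 2: "- (rp * (rd - 1) / n * (e \<bullet> (A *v d'))) \<le> rp / (4 * \<tau>) * (norm d')\<^sup>2 + rd / (4 * \<sigma>) * (norm e)\<^sup>2"
  proof -
    have "- (rp * (rd - 1) / n * (e \<bullet> (A *v d'))) = rp * (rd - 1) / n * (- (e \<bullet> (A *v d')))" by simp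
    also have "\<dots> \<le> rp * (rd - 1) / n * (sqrt \<Lambda> * norm d' * norm e)"
      using block_inner_le[OF I J' d' e] rd_ge pos n_pos by (intro mult_left_mono) auto
    also have "\<dots> \<le> rp * rd / n * (sqrt \<Lambda> * norm d' * norm e)"
      using rd_ge pos n_pos \<Lambda> by (intro mult_right_mono divide_right_mono mult_left_mono) auto
    also have "\<dots> = k * norm d' * norm e" unfolding k_def by simp
    finally show ?thesis using amgm[of d'] by linarith
  qed
  have 3: "(a - lam / 2) * (norm (x - xstar))\<^sup>2 \<le> rho * (a * (norm (x - xstar))\<^sup>2)"
    using mult_right_mono[OF contraction_primal, of "(norm (x - xstar))\<^sup>2"] by (simp add: mult.assoc)
  have 4: "(b - \<gamma> / n / 2) * (norm (y - ystar))\<^sup>2 \<le> rho * (b * (norm (y - ystar))\<^sup>2)"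
    using mult_right_mono[OF contraction_dual, of "(norm (y - ystar))\<^sup>2"] by (simp add: mult.assoc)
  have 5: "(rp - 1) * G x \<le> rho * (rp * G x)" "(rd - 1) * H y \<le> rho * (rd * H y)"
    using mult_right_mono[OF contraction_gap(1) G_nonneg[of x]]
      mult_right_mono[OF contraction_gap(2) H_nonneg[OF y]] by (simp_all add: mult.assoc)
  \<comment> \<open>An equality, as the term has no sign: this is where the value of
    \<open>\<theta>\<close> matters.\<close>
  have 6: "\<theta> / n * ((y - ystar) \<bullet> (A *v d)) = rho * (rp / n * ((y - ystar) \<bullet> (A *v d)))"
    unfolding theta by simp
  have 7: "rd / (2 * \<sigma>) * (norm e)\<^sup>2 = rd / (4 * \<sigma>) * (norm e)\<^sup>2 + rd / (4 * \<sigma>) * (norm e)\<^sup>2"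
    by simp
  show ?thesis
    unfolding W_step_identity unfolding W_def distrib_left using 1 2 3 4 5 6 7 by linarith
qed

section \<open>Proximal inequalities for the random updates\<close>

lemma dual_update_prox:
  fixes xbar :: "real^'p"
  assumes "y \<in> dom"
  defines "new \<equiv> dual_update A \<phi> \<sigma> UNIV xbar y"
  shows "new \<in> dom"
    and "0 \<le> measure_pmf.expectation (pmf_of_set {I :: 'n set. card I = m})
      (\<lambda>I. dual_gain xbar y (dual_update A \<phi> \<sigma> I xbar y))"
proof -
  have *: "convex_conjugate (\<phi> i) (new $ i) \<noteq> \<infinity> \<and>
      (- (1 / n) *\<^sub>R (A *v xbar)) $ i * ystar $ i + conj_real i (ystar $ i) / n
        + 1 / (2 * \<sigma>) * (ystar $ i - y $ i)\<^sup>2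
      \<ge> (- (1 / n) *\<^sub>R (A *v xbar)) $ i * new $ i + conj_real i (new $ i) / n
        + 1 / (2 * \<sigma>) * (new $ i - y $ i)\<^sup>2
         + (1 / (2 * \<sigma>) + \<gamma> / n / 2) * (ystar $ i - new $ i)\<^sup>2" for i
  proof -
    obtain \<beta> r where \<beta>: "arg_max (\<lambda>\<beta>. ereal (1 / n * (row i A \<bullet> xbar) * \<beta>)
          - convex_conjugate (\<phi> i) \<beta> / ereal n - ereal (1 / (2 * \<sigma>) * (\<beta> - y $ i)\<^sup>2)) (\<lambda>_. True) = \<beta>"
      and r: "convex_conjugate (\<phi> i) \<beta> = ereal r"
      and gap: "\<forall>b s. convex_conjugate (\<phi> i) b = ereal s \<longrightarrow>
       - (row i A \<bullet> xbar / n) * b + s / n + 1 / (2 * \<sigma>) * (b - y $ i)\<^sup>2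
       \<ge> - (row i A \<bullet> xbar / n) * \<beta> + r / n + 1 / (2 * \<sigma>) * (\<beta> - y $ i)\<^sup>2
          + (1 / (2 * \<sigma>) + \<gamma> / n / 2) * (b - \<beta>)\<^sup>2"
      by (rule conjugate_prox[OF \<phi>_smooth[of i] \<phi>_convex[of i] gam \<sigma> n_pos, where c = "row i A \<bullet> xbar" and y = "y $ i"])
    have new: "new $ i = \<beta>"
      unfolding new_def dual_update_def n[symmetric] using \<beta> by simp
    have "conj_real i \<beta> = r" unfolding conj_real_def r by simp
    with gap[rule_format, OF conj_real[OF ystar_dom_eq_yhat(1), of i]] show ?thesis
      unfolding new by (simp add: r row_inner_eq)
  qed
  \<comment> \<open>A dual proximal point has a finite conjugate value, so the iteration never
    leaves \<open>dom\<close>.\<close>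
  show "new \<in> dom" using * unfolding dom_def by simp
  have "0 < m" "m \<le> CARD('n)" using m by auto
  note gap = random_prox_gap[OF this, where w = "- (1 / n) *\<^sub>R (A *v xbar)" and z = ystar
      and \<psi> = "\<lambda>i \<beta>. conj_real i \<beta> / n" and \<tau> = \<sigma> and old = y and new = new and \<mu> = "\<gamma> / n",
      OF conjunct2[OF *], folded n, folded rd_def, folded b_def h_def]
  have block: "dual_update A \<phi> \<sigma> I xbar y = (\<chi> i. if i \<in> I then new $ i else y $ i)" for I
    unfolding new_def by (rule dual_update_block)
  show "0 \<le> measure_pmf.expectation (pmf_of_set {I :: 'n set. card I = m})
      (\<lambda>I. dual_gain xbar y (dual_update A \<phi> \<sigma> I xbar y))"
    unfolding dual_gain_def block by (rule gap)
qed

text \<open>\<open>ybar\<close> is arbitrary, so the inequality can be applied conditionally on the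
  dual block that produced it.\<close>

lemma primal_update_prox:
  "0 \<le> measure_pmf.expectation (pmf_of_set {J :: 'p set. card J = q})
      (\<lambda>J. primal_gain ybar x (primal_update A g \<tau> J ybar x))"
proof -
  define new where "new = primal_update A g \<tau> UNIV ybar x"
  define w where "w = (1 / n) *\<^sub>R (transpose A *v ybar)"
  have *: "w $ j * xstar $ j + g j (xstar $ j) + 1 / (2 * \<tau>) * (xstar $ j - x $ j)\<^sup>2
      \<ge> w $ j * new $ j + g j (new $ j) + 1 / (2 * \<tau>) * (new $ j - x $ j)\<^sup>2
         + (1 / (2 * \<tau>) + lam / 2) * (xstar $ j - new $ j)\<^sup>2" for j
  proof -
    have "new $ j = arg_min (\<lambda>\<alpha>. w $ j * \<alpha> + g j \<alpha> + 1 / (2 * \<tau>) * (\<alpha> - x $ j)\<^sup>2) (\<lambda>_. True)"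
      unfolding new_def primal_update_def w_def n[symmetric] column_inner_eq by simp
    then show ?thesis using prox_gap[OF g_sc _ \<tau>] lam by simp
  qed
  have "0 < q" "q \<le> CARD('p)" using q by auto
  note gap = random_prox_gap[OF this, where w = w and z = xstar and \<psi> = g and \<tau> = \<tau>
      and old = x and new = new and \<mu> = lam, OF *, folded p, folded rp_def, folded a_def]
  have block: "primal_update A g \<tau> J ybar x = (\<chi> j. if j \<in> J then new $ j else x $ j)" for J
    unfolding new_def by (rule primal_update_block)
  show ?thesis
    unfolding primal_gain_def block w_def[symmetric] by (rule gap)
qed

text \<open>The state does not contain the previous iterate; the last increment is recovered from the
  extrapolation as \<open>(xbar - x) / \<theta>\<close>.\<close>

definition V :: "(real^'p) \<times> (real^'p) \<times> (real^'n) \<Rightarrow> real" where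
  "V = (\<lambda>(x, xbar, y). W x ((1 / \<theta>) *\<^sub>R (xbar - x)) y)"

text \<open>The block that produced the last increment is not stored; its existence is all that the
  block bounds ask for. Initially \<open>xbar = x\<close>, and any block of size \<open>q\<close>
  serves.\<close>

definition Inv :: "((real^'p) \<times> (real^'p) \<times> (real^'n)) set" where
  "Inv = {(x, xbar, y). y \<in> dom \<and> (\<exists>J. card J = q \<and> (\<forall>j. j \<notin> J \<longrightarrow> xbar $ j = x $ j))}"

section \<open>Contraction of the potential along the random iteration\<close>

definition next_state :: "(real^'p) \<Rightarrow> (real^'p) \<Rightarrow> (real^'n) \<Rightarrow> 'n set \<Rightarrow> 'p set
    \<Rightarrow> (real^'p) \<times> (real^'p) \<times> (real^'n)" where
  "next_state x xbar y I J =
     (let y' = dual_update A \<phi> \<sigma> I xbar y;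
          x' = primal_update A g \<tau> J (y + rd *\<^sub>R (y' - y)) x
      in (x', x + (\<theta> + 1) *\<^sub>R (x' - x), y'))"

lemma dspdc_step_eq:
  "dspdc_step A \<phi> g m q \<theta> \<tau> \<sigma> (x, xbar, y)
   = bind_pmf (pmf_of_set {I. card I = m}) (\<lambda>I. bind_pmf (pmf_of_set {J. card J = q})
       (\<lambda>J. return_pmf (next_state x xbar y I J)))"
  unfolding dspdc_step_def next_state_def Let_def rd_def n[symmetric] by simp

lemma next_state_Inv:
  assumes "(x, xbar, y) \<in> Inv" "card J = q"
  shows "next_state x xbar y I J \<in> Inv"
proof -
  have y: "y \<in> dom" using assms unfolding Inv_def by simp
  have "dual_update A \<phi> \<sigma> I xbar y \<in> dom"
    using dual_update_prox(1)[OF y, of xbar] y unfolding dual_update_block[of A \<phi> \<sigma> I] dom_def by auto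
  moreover have "(x + (\<theta> + 1) *\<^sub>R (x' - x)) $ j = x' $ j"
    if "x' = primal_update A g \<tau> J yb x" "j \<notin> J" for j x' yb
    using that by (simp add: primal_update_def)
  ultimately show ?thesis
    using assms(2) unfolding Inv_def next_state_def Let_def by auto
qed

lemma V_next_state:
  assumes "(x, xbar, y) \<in> Inv" "card I = m" "card J = q"
  shows "V (next_state x xbar y I J)
    \<le> rho * V (x, xbar, y) - dual_gain xbar y (dual_update A \<phi> \<sigma> I xbar y)
      - primal_gain (y + rd *\<^sub>R (dual_update A \<phi> \<sigma> I xbar y - y)) x
          (primal_update A g \<tau> J (y + rd *\<^sub>R (dual_update A \<phi> \<sigma> I xbar y - y)) x)"
proof -
  define y' where "y' = dual_update A \<phi> \<sigma> I xbar y"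
  define x' where "x' = primal_update A g \<tau> J (y + rd *\<^sub>R (y' - y)) x"
  define d where "d = (1 / \<theta>) *\<^sub>R (xbar - x)"
  obtain J0 where J0: "card J0 = q" "\<And>j. j \<notin> J0 \<Longrightarrow> xbar $ j = x $ j" and y: "y \<in> dom"
    using assms(1) unfolding Inv_def by auto
  have d: "d $ j = 0" if "j \<notin> J0" for j using J0(2)[OF that] unfolding d_def by simp
  have xbar: "xbar = x + \<theta> *\<^sub>R d" unfolding d_def using theta_pos by simp
  have "(x' - x) $ j = 0" if "j \<notin> J" for j
    using that unfolding x'_def by (simp add: primal_update_def)
  moreover have "(y' - y) $ i = 0" if "i \<notin> I" for i
    using that unfolding y'_def by (simp add: dual_update_def)
  ultimately have "W (x + (x' - x)) (x' - x) (y + (y' - y)) + dual_gain (x + \<theta> *\<^sub>R d) y (y + (y' - y))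
      + primal_gain (y + rd *\<^sub>R (y' - y)) x (x + (x' - x)) \<le> rho * W x d y"
    by (intro W_step[OF assms(2) J0(1) assms(3) d]) (use y in auto)
  moreover have "V (next_state x xbar y I J) = W x' (x' - x) y'"
  proof -
    have "(1 / \<theta>) *\<^sub>R (x + (\<theta> + 1) *\<^sub>R (x' - x) - x') = x' - x"
    proof -
      have "x + (\<theta> + 1) *\<^sub>R (x' - x) - x' = \<theta> *\<^sub>R (x' - x)" by (simp add: algebra_simps)
      then show ?thesis using theta_pos by simp
    qed
    then show ?thesis
      unfolding V_def next_state_def Let_def y'_def[symmetric] x'_def[symmetric] by simp
  qed
  moreover have "V (x, xbar, y) = W x d y" unfolding V_def d_def by simp
  ultimately show ?thesis
    unfolding xbar[symmetric] y'_def[symmetric] x'_def[symmetric] by simp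
qed

lemma finite_set_dspdc_step: "finite (set_pmf (dspdc_step A \<phi> g m q \<theta> \<tau> \<sigma> s))"
  by (cases s) (simp add: dspdc_step_eq)

lemma dspdc_step_Inv:
  assumes "s \<in> Inv" "s' \<in> set_pmf (dspdc_step A \<phi> g m q \<theta> \<tau> \<sigma> s)"
  shows "s' \<in> Inv"
proof -
  obtain x xbar y where s: "s = (x, xbar, y)" by (cases s)
  have "q \<le> CARD('p)" using q by simp
  then show ?thesis
    using assms next_state_Inv unfolding s dspdc_step_eq by (auto simp: set_pmf_subsets_of_size)
qed

text \<open>For a fixed dual block, averaging over \<open>J\<close> removes the primal gain, since
  its mean is nonnegative; averaging over \<open>I\<close> then removes the dual gain.\<close>

lemma dspdc_step_V:
  assumes "s \<in> Inv"
  shows "measure_pmf.expectation (dspdc_step A \<phi> g m q \<theta> \<tau> \<sigma> s) V \<le> rho * V s"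
proof -
  obtain x xbar y where s: "s = (x, xbar, y)" by (cases s)
  define MI where "MI = pmf_of_set {I :: 'n set. card I = m}"
  define MJ where "MJ = pmf_of_set {J :: 'p set. card J = q}"
  define DG where "DG I = dual_gain xbar y (dual_update A \<phi> \<sigma> I xbar y)" for I
  define yb where "yb I = y + rd *\<^sub>R (dual_update A \<phi> \<sigma> I xbar y - y)" for I
  define PG where "PG I J = primal_gain (yb I) x (primal_update A g \<tau> J (yb I) x)" for I J
  have y: "y \<in> dom" using assms unfolding s Inv_def by simp
  have fin: "finite (set_pmf MI)" "finite (set_pmf MJ)" by simp_all
  have MI: "set_pmf MI = {I. card I = m}" and MJ: "set_pmf MJ = {J. card J = q}"
    unfolding MI_def MJ_def using m q by (simp_all add: set_pmf_subsets_of_size)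
  have "measure_pmf.expectation (dspdc_step A \<phi> g m q \<theta> \<tau> \<sigma> s) V
    = measure_pmf.expectation MI (\<lambda>I. measure_pmf.expectation MJ (\<lambda>J. V (next_state x xbar y I J)))"
    unfolding s dspdc_step_eq MI_def[symmetric] MJ_def[symmetric]
    by (simp add: expectation_bind_finite)
  also have "\<dots> \<le> measure_pmf.expectation MI (\<lambda>I. rho * V s - DG I)"
  proof (rule expectation_mono_finite[OF fin(1)])
    fix I assume "I \<in> set_pmf MI"
    then have I: "card I = m" unfolding MI by simp
    have "measure_pmf.expectation MJ (\<lambda>J. V (next_state x xbar y I J))
      \<le> measure_pmf.expectation MJ (\<lambda>J. (rho * V s - DG I) - PG I J)"
      using V_next_state[OF assms[unfolded s] I] fin(2)
      by (intro expectation_mono_finite) (auto simp: MJ s DG_def PG_def yb_def)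
    also have "\<dots> = (rho * V s - DG I) - measure_pmf.expectation MJ (PG I)"
      by (subst Bochner_Integration.integral_diff) (auto intro: integrable_measure_pmf_finite fin)
    also have "\<dots> \<le> rho * V s - DG I"
      using primal_update_prox[of "yb I" x] unfolding PG_def MJ_def by simp
    finally show "measure_pmf.expectation MJ (\<lambda>J. V (next_state x xbar y I J)) \<le> rho * V s - DG I" .
  qed
  also have "\<dots> = rho * V s - measure_pmf.expectation MI DG"
    by (subst Bochner_Integration.integral_diff) (auto intro: integrable_measure_pmf_finite fin)
  also have "\<dots> \<le> rho * V s"
    using dual_update_prox(2)[OF y, of xbar] unfolding DG_def MI_def by simp
  finally show ?thesis .
qed

lemma dspdc_V:
  assumes "y0 \<in> dom"
  shows "finite (set_pmf (dspdc A \<phi> g m q \<theta> \<tau> \<sigma> x0 y0 t))"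
    and "set_pmf (dspdc A \<phi> g m q \<theta> \<tau> \<sigma> x0 y0 t) \<subseteq> Inv"
    and "measure_pmf.expectation (dspdc A \<phi> g m q \<theta> \<tau> \<sigma> x0 y0 t) V \<le> rho ^ t * V (x0, x0, y0)"
proof (induction t)
  case 0
  have "q \<le> CARD('p)" using q by simp
  then obtain J :: "'p set" where "card J = q"
    using subsets_of_size_nonempty[where ?'k = 'p, of q] by blast
  then have "(x0, x0, y0) \<in> Inv" using assms unfolding Inv_def by auto
  then show "finite (set_pmf (dspdc A \<phi> g m q \<theta> \<tau> \<sigma> x0 y0 0))"
    "set_pmf (dspdc A \<phi> g m q \<theta> \<tau> \<sigma> x0 y0 0) \<subseteq> Inv"
    "measure_pmf.expectation (dspdc A \<phi> g m q \<theta> \<tau> \<sigma> x0 y0 0) V \<le> rho ^ 0 * V (x0, x0, y0)"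
    by simp_all
next
  case (Suc t)
  let ?M = "dspdc A \<phi> g m q \<theta> \<tau> \<sigma> x0 y0 t"
  show "finite (set_pmf (dspdc A \<phi> g m q \<theta> \<tau> \<sigma> x0 y0 (Suc t)))"
    using Suc(1) finite_set_dspdc_step by simp
  show "set_pmf (dspdc A \<phi> g m q \<theta> \<tau> \<sigma> x0 y0 (Suc t)) \<subseteq> Inv"
    using Suc(2) dspdc_step_Inv by auto
  have "measure_pmf.expectation (dspdc A \<phi> g m q \<theta> \<tau> \<sigma> x0 y0 (Suc t)) V
    = measure_pmf.expectation ?M (\<lambda>s. measure_pmf.expectation (dspdc_step A \<phi> g m q \<theta> \<tau> \<sigma> s) V)"
    using Suc(1) finite_set_dspdc_step by (simp add: expectation_bind_finite)
  also have "\<dots> \<le> measure_pmf.expectation ?M (\<lambda>s. rho * V s)"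
    using Suc(1,2) dspdc_step_V by (intro expectation_mono_finite) auto
  also have "\<dots> = rho * measure_pmf.expectation ?M V" by simp
  also have "\<dots> \<le> rho * (rho ^ t * V (x0, x0, y0))"
    using Suc(3) rho by (intro mult_left_mono) auto
  finally show "measure_pmf.expectation (dspdc A \<phi> g m q \<theta> \<tau> \<sigma> x0 y0 (Suc t)) V
      \<le> rho ^ Suc t * V (x0, x0, y0)" by (simp add: mult.assoc)
qed

section \<open>From the potential to the duality gap\<close>

definition C :: real where
  "C = 1 / min rp rd + max ((spectral_norm A)\<^sup>2 / (n * \<gamma>)) ((spectral_norm A)\<^sup>2 / (lam * n\<^sup>2))
     / min (lam * rp) (\<gamma> / real m)"

lemma C_pos: "C > 0"
proof -
  have "max ((spectral_norm A)\<^sup>2 / (n * \<gamma>)) ((spectral_norm A)\<^sup>2 / (lam * n\<^sup>2))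
     / min (lam * rp) (\<gamma> / real m) \<ge> 0"
    using n_pos gam lam rp_ge m_pos by (intro divide_nonneg_nonneg) (auto simp: le_max_iff_disj)
  moreover have "1 / min rp rd > 0" using rp_ge rd_ge by simp
  ultimately show ?thesis unfolding C_def by linarith
qed

text \<open>The first summand of \<open>C\<close> pays for \<open>G x + H y\<close> through the
  weights \<open>rp\<close> and \<open>rd\<close>; the second pays for the quadratic remainders
  through the squared distances in the potential.\<close>

lemma gap_le_V:
  assumes "(x, xbar, y) \<in> Inv"
  obtains d where "dual_obj A \<phi> g y = ereal d"
    "0 \<le> primal_obj A \<phi> g x - d" "primal_obj A \<phi> g x - d \<le> C * V (x, xbar, y)"
proof -
  define K where "K = (spectral_norm A)\<^sup>2"
  define M where "M = max (K / (n * \<gamma>)) (K / (lam * n\<^sup>2))"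
  define r where "r = min (lam * rp) (\<gamma> / real m)"
  define u where "u = (norm (x - xstar))\<^sup>2"
  define v where "v = (norm (y - ystar))\<^sup>2"
  obtain J where J: "card J = q" "\<And>j. j \<notin> J \<Longrightarrow> xbar $ j = x $ j" and y: "y \<in> dom"
    using assms unfolding Inv_def by auto
  obtain d where d: "dual_obj A \<phi> g y = ereal d" "G x + H y \<le> primal_obj A \<phi> g x - d"
    "primal_obj A \<phi> g x - d \<le> G x + H y + K / (2 * n * \<gamma>) * u + K / (2 * lam * n\<^sup>2) * v"
    using dual_obj_real[OF y, of x] unfolding K_def u_def v_def by metis
  have GH: "G x \<ge> 0" "H y \<ge> 0" using G_nonneg H_nonneg[OF y] by auto
  have pos: "rp > 0" "rd > 0" using rp_ge rd_ge by auto
  have r: "r > 0" unfolding r_def using lam pos gam m_pos by simp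
  have uv: "u \<ge> 0" "v \<ge> 0" unfolding u_def v_def by auto
  have M: "M \<ge> 0" unfolding M_def K_def using n_pos gam by (simp add: le_max_iff_disj)
  define mn where "mn = min rp rd"
  have mn: "mn > 0" unfolding mn_def using pos by simp
  define T where "T = rp * G x + rd * H y"
  define Q where "Q = rp * lam / 2 * u + \<gamma> / (2 * real m) * v"
  have T: "G x + H y \<le> 1 / mn * T"
  proof -
    have "mn * (G x + H y) \<le> T"
      unfolding T_def distrib_left using GH by (intro add_mono mult_right_mono) (auto simp: mn_def)
    then show ?thesis using mn by (simp add: field_simps)
  qed
  have T0: "T \<ge> 0" unfolding T_def using pos GH by simp
  have Q: "K / (2 * n * \<gamma>) * u + K / (2 * lam * n\<^sup>2) * v \<le> M / r * Q"
  proof -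
    have "K / (2 * n * \<gamma>) * u + K / (2 * lam * n\<^sup>2) * v = K / (n * \<gamma>) * (u / 2) + K / (lam * n\<^sup>2) * (v / 2)"
      by simp
    also have "\<dots> \<le> M * (u / 2) + M * (v / 2)"
      unfolding M_def using uv by (intro add_mono mult_right_mono) auto
    also have "\<dots> = M / r * (r * (u / 2) + r * (v / 2))"
      using r by (simp add: field_simps)
    also have "\<dots> \<le> M / r * (lam * rp * (u / 2) + \<gamma> / real m * (v / 2))"
      using M r uv by (intro mult_left_mono add_mono mult_right_mono) (auto simp: r_def)
    also have "\<dots> = M / r * Q" unfolding Q_def by (simp add: mult_ac)
    finally show ?thesis .
  qed
  have Q0: "Q \<ge> 0" unfolding Q_def using pos lam uv gam by simp
  have V: "V (x, xbar, y) \<ge> Q + T"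
    using W_ge[OF J(1), of "(1 / \<theta>) *\<^sub>R (xbar - x)" x y] J(2)
    unfolding V_def Q_def T_def u_def v_def by simp
  have C: "C = 1 / mn + M / r" unfolding C_def mn_def M_def r_def K_def by simp
  have "primal_obj A \<phi> g x - d \<le> 1 / mn * T + M / r * Q" using d(3) T Q by linarith
  \<comment> \<open>The mixed products are nonnegative and can be added, which is why the two
    constants appear as a sum.\<close>
  also have "\<dots> \<le> C * (Q + T)"
  proof -
    have "C * (Q + T) = 1 / mn * T + M / r * Q + (1 / mn * Q + M / r * T)"
      unfolding C distrib_left distrib_right by simp
    moreover have "1 / mn * Q + M / r * T \<ge> 0"
      using mn Q0 M r T0 by (intro add_nonneg_nonneg mult_nonneg_nonneg) auto
    ultimately show ?thesis by linarith
  qed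
  also have "\<dots> \<le> C * V (x, xbar, y)" using V C_pos by (intro mult_left_mono) auto
  finally show ?thesis using that d GH by fastforce
qed

text \<open>At the start \<open>xbar = x\<close>, so the increment and the cross term vanish, and
  \<open>G x0 + H y0\<close> is at most the duality gap.\<close>

lemma V_init_le:
  assumes "y0 \<in> dom"
  obtains d where "dual_obj A \<phi> g y0 = ereal d"
    "V (x0, x0, y0) \<le> a * (norm (x0 - xstar))\<^sup>2 + b * (norm (y0 - ystar))\<^sup>2
       + max rp rd * (primal_obj A \<phi> g x0 - d)"
proof -
  obtain d where d: "dual_obj A \<phi> g y0 = ereal d" "G x0 + H y0 \<le> primal_obj A \<phi> g x0 - d"
    using dual_obj_real[OF assms, of x0] by metis
  have "rp * G x0 + rd * H y0 \<le> max rp rd * G x0 + max rp rd * H y0"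
    using G_nonneg H_nonneg[OF assms] by (intro add_mono mult_right_mono) auto
  also have "\<dots> = max rp rd * (G x0 + H y0)" by (simp add: distrib_left)
  also have "\<dots> \<le> max rp rd * (primal_obj A \<phi> g x0 - d)"
    using d(2) rp_ge by (intro mult_left_mono) auto
  finally show ?thesis
    using that[OF d(1)] unfolding V_def W_def by simp
qed

lemma expected_gap_le:
  "ereal_expectation (dspdc A \<phi> g m q \<theta> \<tau> \<sigma> x0 y0 t)
     (\<lambda>(x, xbar, y). ereal (primal_obj A \<phi> g x) - dual_obj A \<phi> g y)
   \<le> ereal (rho ^ t) * ereal C
      * (ereal (a * (norm (x0 - xstar))\<^sup>2 + b * (norm (y0 - ystar))\<^sup>2)
         + ereal (max rp rd) * (ereal (primal_obj A \<phi> g x0) - dual_obj A \<phi> g y0))"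
proof (cases "y0 \<in> dom")
  \<comment> \<open>The initial dual value is minus infinity, and the positive factors keep the
    bound at infinity.\<close>
  case False
  have "max rp rd > 0" using rp_ge by simp
  moreover have "rho > 0" "C > 0" using rho C_pos by auto
  moreover have "ereal r + ereal s * (ereal u - -\<infinity>) = \<infinity>" if "s > 0" for r s u
    using that by simp
  ultimately have "ereal (rho ^ t) * ereal C
      * (ereal (a * (norm (x0 - xstar))\<^sup>2 + b * (norm (y0 - ystar))\<^sup>2)
         + ereal (max rp rd) * (ereal (primal_obj A \<phi> g x0) - dual_obj A \<phi> g y0)) = \<infinity>"
    unfolding dual_obj_not_dom[OF False] by (simp only: times_ereal.simps) simp
  then show ?thesis by (simp only: ereal_less_eq(1))
next
  case True
  let ?M = "dspdc A \<phi> g m q \<theta> \<tau> \<sigma> x0 y0 t"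
  define F where "F = (\<lambda>(x, xbar :: real^'p, y). ereal (primal_obj A \<phi> g x) - dual_obj A \<phi> g y)"
  define f where "f s = real_of_ereal (F s)" for s
  note iter = dspdc_V[OF True, of x0 t]
  have F: "F s = ereal (f s)" "0 \<le> f s" "f s \<le> C * V s" if s: "s \<in> set_pmf ?M" for s
  proof -
    obtain x xbar y where s': "s = (x, xbar, y)" by (cases s)
    then have "(x, xbar, y) \<in> Inv" using s iter(2) by auto
    then obtain d where "dual_obj A \<phi> g y = ereal d"
      "0 \<le> primal_obj A \<phi> g x - d" "primal_obj A \<phi> g x - d \<le> C * V (x, xbar, y)"
      by (rule gap_le_V)
    then show "F s = ereal (f s)" "0 \<le> f s" "f s \<le> C * V s"
      unfolding f_def F_def s' by auto
  qed
  have "(\<integral>\<^sup>+ s. e2ennreal (F s) \<partial>measure_pmf ?M) = (\<integral>\<^sup>+ s. ennreal (f s) \<partial>measure_pmf ?M)"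
    by (intro nn_integral_cong_AE) (auto simp: AE_measure_pmf_iff F(1) ennreal.abs_eq)
  also have "\<dots> = ennreal (measure_pmf.expectation ?M f)"
    using F(2) iter(1)
    by (intro nn_integral_eq_integral integrable_measure_pmf_finite) (auto simp: AE_measure_pmf_iff)
  finally have plus: "(\<integral>\<^sup>+ s. e2ennreal (F s) \<partial>measure_pmf ?M) = ennreal (measure_pmf.expectation ?M f)" .
  \<comment> \<open>The gap is nonnegative on the support, so the extended expectation reduces to an
    ordinary finite one.\<close>
  have minus: "(\<integral>\<^sup>+ s. e2ennreal (- F s) \<partial>measure_pmf ?M) = 0"
  proof -
    have "(\<integral>\<^sup>+ s. e2ennreal (- F s) \<partial>measure_pmf ?M) = (\<integral>\<^sup>+ s. 0 \<partial>measure_pmf ?M)"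
      using F(1,2) by (intro nn_integral_cong_AE) (auto simp: AE_measure_pmf_iff e2ennreal_neg ennreal_neg)
    then show ?thesis by simp
  qed
  have "measure_pmf.expectation ?M f \<ge> 0"
    using F(2) by (intro integral_nonneg_AE) (auto simp: AE_measure_pmf_iff)
  then have eq: "ereal_expectation ?M F = ereal (measure_pmf.expectation ?M f)"
    unfolding ereal_expectation_def plus minus by (simp add: enn2ereal_ennreal zero_ennreal.rep_eq)
  have "measure_pmf.expectation ?M f \<le> measure_pmf.expectation ?M (\<lambda>s. C * V s)"
    using F(3) iter(1) by (intro expectation_mono_finite) auto
  also have "\<dots> = C * measure_pmf.expectation ?M V" by simp
  also have "\<dots> \<le> C * (rho ^ t * V (x0, x0, y0))"
    using iter(3) C_pos by (intro mult_left_mono) auto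
  finally have bound: "measure_pmf.expectation ?M f \<le> rho ^ t * C * V (x0, x0, y0)"
    by (simp add: mult_ac)
  obtain d where d: "dual_obj A \<phi> g y0 = ereal d"
    "V (x0, x0, y0) \<le> a * (norm (x0 - xstar))\<^sup>2 + b * (norm (y0 - ystar))\<^sup>2
       + max rp rd * (primal_obj A \<phi> g x0 - d)"
    using V_init_le[OF True, of x0] by metis
  note bound
  also have "rho ^ t * C * V (x0, x0, y0) \<le> rho ^ t * C * (a * (norm (x0 - xstar))\<^sup>2
      + b * (norm (y0 - ystar))\<^sup>2 + max rp rd * (primal_obj A \<phi> g x0 - d))"
    using d(2) C_pos rho by (intro mult_left_mono) auto
  finally show ?thesis
    unfolding F_def[symmetric] eq d(1)
    by (simp only: ereal_minus(1) times_ereal.simps plus_ereal.simps ereal_less_eq(3))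
qed

end

theorem theorem2:
  fixes A :: "real^'p^'n"
    and \<phi> :: "'n \<Rightarrow> real \<Rightarrow> real" and g :: "'p \<Rightarrow> real \<Rightarrow> real"
    and n p m q t :: nat
    and lam \<gamma> \<Lambda> \<tau> \<sigma> \<theta> :: real
    and x0 xstar :: "real^'p" and y0 ystar :: "real^'n"
  assumes "n = CARD('n)" and "p = CARD('p)"
    and "lam > 0" and "\<gamma> > 0"
    and "\<And>j. strongly_convex lam (g j)"
    and "\<And>i. convex_on UNIV (\<phi> i)" and "\<And>i. smooth (1 / \<gamma>) (\<phi> i)"
    and "is_arg_min (primal_obj A \<phi> g) (\<lambda>_. True) xstar"
    and "is_arg_max (dual_obj A \<phi> g) (\<lambda>_. True) ystar"
    and "m \<in> {1..n}" and "q \<in> {1..p}"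
    and "\<Lambda> > 0" and "\<Lambda> \<ge> Lambda_max A q m"
    and "\<tau> > 0" and "\<sigma> > 0"
    and "\<tau> * \<sigma> = real n * real m * real q / (4 * real p * \<Lambda>)"
    and "real p / (2 * real q * lam * \<tau>) + real p / real q
         = (real n)\<^sup>2 / (2 * real m * \<gamma> * \<sigma>) + real n / real m"
    and "\<theta> = real p / real q
         - (real p / real q)
           / (2 * sqrt (\<Lambda> / (lam * \<gamma> * real n)) * ((real n * real p) / (real m * real q))
              + 2 * max (real n / real m) (real p / real q))"
  shows "ereal_expectation (dspdc A \<phi> g m q \<theta> \<tau> \<sigma> x0 y0 t)
           (\<lambda>(x, xbar, y). ereal (primal_obj A \<phi> g x) - dual_obj A \<phi> g y)
    \<le> ereal ((1 - 1 / (2 * sqrt (\<Lambda> / (lam * \<gamma> * real n)) * ((real n * real p) / (real m * real q))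
                       + 2 * max (real n / real m) (real p / real q))) ^ t)
      * ereal (1 / min (real p / real q) (real n / real m)
               + max ((spectral_norm A)\<^sup>2 / (real n * \<gamma>)) ((spectral_norm A)\<^sup>2 / (lam * (real n)\<^sup>2))
                 / min (lam * real p / real q) (\<gamma> / real m))
      * (ereal ((real p / (2 * real q * \<tau>) + real p * lam / (2 * real q)) * (norm (x0 - xstar))\<^sup>2
                + (real n / (2 * real m * \<sigma>) + \<gamma> / (2 * real m)) * (norm (y0 - ystar))\<^sup>2)
         + ereal (max (real p / real q) (real n / real m))
           * (ereal (primal_obj A \<phi> g x0) - dual_obj A \<phi> g y0))"
proof -
  interpret dspdc_problem A \<phi> g "real n" lam \<gamma> xstar ystar "real p" m q \<Lambda> \<tau> \<sigma> \<theta>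
    using assms by unfold_locales auto
  have a: "a = real p / (2 * real q * \<tau>) + real p * lam / (2 * real q)"
    unfolding a_def rp_def by (simp add: mult_ac)
  have b: "b = real n / (2 * real m * \<sigma>) + \<gamma> / (2 * real m)"
    unfolding b_def rd_over_n[symmetric] rd_def using n_pos by (simp add: mult_ac)
  show ?thesis
    using expected_gap_le[of x0 y0 t]
    unfolding a b rho_def R_def C_def rp_def rd_def
    by (simp add: mult_ac max.commute)
qed

end
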